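(* Let $d,L\ge1$, let $m,n\ge0$, and let $\alpha,\beta\in\Lambda_{d,L}$ be such that $|\alpha|+m=|\beta|+n$. For any $w\in W_{m,n}$, there is a bijection between $\mathrm{OCT}^w_{d,L}(\alpha,\beta)$ and the set of cylindric growth diagrams on an $m\times n$ grid where vertex $(0,n)$ has label $\alpha$ and vertex $(m,0)$ has label $\beta$. In particular, $|\mathrm{OCT}^w_{d,L}(\alpha,\beta)|$ is independent of $w\in W_{m,n}$, and it equals $$\sum_{\substack{\mu\subseteq\alpha,\beta\\ |\alpha/\mu|=n,\ |\beta/\mu|=m}} |\mathrm{SCT}_{d,L}(\alpha/\mu)|\,|\mathrm{SCT}_{d,L}(\beta/\mu)|=\sum_{\substack{\lambda\supseteq\alpha,\beta\\ |\lambda/\beta|=n,\ |\lambda/\alpha|=m}} |\mathrm{SCT}_{d,L}(\lambda/\beta)|\,|\mathrm{SCT}_{d,L}(\lambda/\alpha)|,$$ where the sums are over $\mu,\lambda\in\Lambda_{d,L}$.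
   Context: Cylindric shapes and tableaux. The cylinder is $\mathcal{C}_{d,L}=\mathbb{Z}^2/(-d,L)\mathbb{Z}$; its elements (cells) are classes $\langle i,j\rangle=(i,j)+(-d,L)\mathbb{Z}$, where $i$ is the row and $j$ the column. A cylindric shape of period $(d,L)$ is a doubly infinite weakly decreasing integer sequence $\lambda=(\lambda_i)_{i\in\mathbb{Z}}$ with $\lambda_i=\lambda_{i+d}+L$ for all $i$. $\Lambda_{d,L}$ is the set of these, and $|\lambda|=\lambda_1+\cdots+\lambda_d$. The Young diagram is $Y_\lambda=\{\langle i,j\rangle: j\le\lambda_i\}$. Write $\mu\subseteq\lambda$ if $\mu_i\le\lambda_i$ for all $i$; then $Y_{\lambda/\mu}=Y_\lambda\setminus Y_\mu$, with cardinality $|\lambda/\mu|=\sum_{i=1}^d(\lambda_i-\mu_i)$. Adding a cell to (removing a cell from) row $i$ of a shape means increasing (decreasing) $\lambda_i$ by $1$, and hence $\lambda_{i+kd}$ by the same amount for all $k\in\mathbb{Z}$, the result being again a shape. $\mathrm{SCT}_{d,L}(\lambda/\mu)$ is the set of standard cylindric tableaux of shape $\lambda/\mu$: fillings of the cells of $Y_{\lambda/\mu}$ with $1,\dots,|\lambda/\mu|$, each used exactly once, increasing along rows (from $\langle i,j\rangle$ to $\langle i,j+1\rangle$) and columns (from $\langle i,j\rangle$ to $\langle i+1,j\rangle$). Oscillating cylindric tableaux. $W_{m,n}\subseteq\{+,-\}^{m+n}$ is the set of words with exactly $m$ pluses and $n$ minuses. For a word $w\in\{+,-\}^N$, $\mathrm{OCT}^w_{d,L}(\alpha,\beta)$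 is the set of sequences $\rho^0,\rho^1,\dots,\rho^N$ in $\Lambda_{d,L}$ with $\rho^0=\alpha$, $\rho^N=\beta$, such that for each $k$, $\rho^k$ is obtained from $\rho^{k-1}$ by adding one cell if the $k$th letter of $w$ is $+$, and by removing one cell if it is $-$. Cylindric growth diagrams. A cylindric growth diagram on an $m\times n$ grid (for standard tableaux) is a labeling of the vertices $(x,y)$, $0\le x\le m$, $0\le y\le n$, by elements of $\Lambda_{d,L}$ such that for every grid edge from $(x,y)$ to $(x+1,y)$ or to $(x,y+1)$ the label of the second endpoint is obtained from that of the first by adding exactly one cell, and such that every unit square, with lower-left, upper-left, lower-right, upper-right labels $\rho^{LL},\rho^{UL},\rho^{LR},\rho^{UR}$, satisfies the forward local rule: (F1) if $\rho^{UL}\ne\rho^{LR}$, then $\rho^{UR}_i=\max\{\rho^{UL}_i,\rho^{LR}_i\}$ for all $i$; (F2) if $\rho^{UL}=\rho^{LR}$, this shape being obtained from $\rho^{LL}$ by adding a cell to row $i$, then $\rho^{UR}$ is obtained from $\rho^{UL}=\rho^{LR}$ by adding a cell to row $i+1$ (row indices modulo $d$). *)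

theory Defs
  imports "HOL-Library.FuncSet"
begin

section \<open>Cylindric shapes and standard cylindric tableaux\<close>

definition shapes :: "int \<Rightarrow> int \<Rightarrow> (int \<Rightarrow> int) set" where
  "shapes d L = {lam. antimono lam \<and> (\<forall>i. lam i = lam (i + d) + L)}"

definition shape_size :: "int \<Rightarrow> (int \<Rightarrow> int) \<Rightarrow> int" where
  "shape_size d lam = (\<Sum>i = 1..d. lam i)"

definition skew_size :: "int \<Rightarrow> (int \<Rightarrow> int) \<Rightarrow> (int \<Rightarrow> int) \<Rightarrow> int" where
  "skew_size d lam mu = (\<Sum>i = 1..d. lam i - mu i)"

text \<open>A cell of the cylinder is a coset of the subgroup of \<open>\<int> \<times> \<int>\<close> generated by \<open>(-d, L)\<close>;
  the first coordinate is the row, the second the column. Containment of shapes is the pointwise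
  order on functions.\<close>

definition cell :: "int \<Rightarrow> int \<Rightarrow> int \<Rightarrow> int \<Rightarrow> (int \<times> int) set" where
  "cell d L i j = {(i - k * d, j + k * L) | k. True}"

definition diagram :: "int \<Rightarrow> int \<Rightarrow> (int \<Rightarrow> int) \<Rightarrow> (int \<times> int) set set" where
  "diagram d L lam = {cell d L i j | i j. j \<le> lam i}"

definition skew_diagram :: "int \<Rightarrow> int \<Rightarrow> (int \<Rightarrow> int) \<Rightarrow> (int \<Rightarrow> int) \<Rightarrow> (int \<times> int) set set" where
  "skew_diagram d L lam mu = diagram d L lam - diagram d L mu"

text \<open>Fillings are extensional, i.e. \<open>undefined\<close> outside the diagram, so that distinct
  functions represent distinct fillings.\<close>

definition SCT :: "int \<Rightarrow> int \<Rightarrow> (int \<Rightarrow> int) \<Rightarrow> (int \<Rightarrow> int) \<Rightarrow> ((int \<times> int) set \<Rightarrow> nat) set" where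
  "SCT d L lam mu =
    {T \<in> extensional (skew_diagram d L lam mu).
       bij_betw T (skew_diagram d L lam mu) {1..nat (skew_size d lam mu)} \<and>
       (\<forall>i j. cell d L i j \<in> skew_diagram d L lam mu \<and> cell d L i (j + 1) \<in> skew_diagram d L lam mu
          \<longrightarrow> T (cell d L i j) < T (cell d L i (j + 1))) \<and>
       (\<forall>i j. cell d L i j \<in> skew_diagram d L lam mu \<and> cell d L (i + 1) j \<in> skew_diagram d L lam mu
          \<longrightarrow> T (cell d L i j) < T (cell d L (i + 1) j))}"


section \<open>Oscillating cylindric tableaux\<close>

definition add_cell :: "int \<Rightarrow> int \<Rightarrow> (int \<Rightarrow> int) \<Rightarrow> int \<Rightarrow> int" where
  "add_cell d i lam = (\<lambda>r. if d dvd r - i then lam r + 1 else lam r)"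

definition remove_cell :: "int \<Rightarrow> int \<Rightarrow> (int \<Rightarrow> int) \<Rightarrow> int \<Rightarrow> int" where
  "remove_cell d i lam = (\<lambda>r. if d dvd r - i then lam r - 1 else lam r)"

datatype sign = Plus | Minus

definition sign_words :: "nat \<Rightarrow> nat \<Rightarrow> sign list set" where
  "sign_words m n = {w. length w = m + n \<and> count_list w Plus = m \<and> count_list w Minus = n}"

fun sign_step :: "int \<Rightarrow> sign \<Rightarrow> (int \<Rightarrow> int) \<Rightarrow> (int \<Rightarrow> int) \<Rightarrow> bool" where
  "sign_step d Plus lam mu = (\<exists>i. mu = add_cell d i lam)"
| "sign_step d Minus lam mu = (\<exists>i. mu = remove_cell d i lam)"

definition OCT ::
  "int \<Rightarrow> int \<Rightarrow> sign list \<Rightarrow> (int \<Rightarrow> int) \<Rightarrow> (int \<Rightarrow> int) \<Rightarrow> (int \<Rightarrow> int) list set" where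
  "OCT d L w al be =
    {rs. length rs = length w + 1 \<and> set rs \<subseteq> shapes d L \<and>
       rs ! 0 = al \<and> rs ! length w = be \<and>
       (\<forall>k < length w. sign_step d (w ! k) (rs ! k) (rs ! (k + 1)))}"


section \<open>Cylindric growth diagrams\<close>

text \<open>Arguments in the order lower-left, upper-left, lower-right, upper-right. In the second
  clause \<open>i\<close> is determined only modulo \<open>d\<close>, and \<^term>\<open>add_cell d i\<close> depends on \<open>i\<close> only
  modulo \<open>d\<close>.\<close>

definition forward_rule ::
  "int \<Rightarrow> (int \<Rightarrow> int) \<Rightarrow> (int \<Rightarrow> int) \<Rightarrow> (int \<Rightarrow> int) \<Rightarrow> (int \<Rightarrow> int) \<Rightarrow> bool" where
  "forward_rule d LL UL LR UR \<longleftrightarrow>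
    (UL \<noteq> LR \<longrightarrow> (\<forall>i. UR i = max (UL i) (LR i))) \<and>
    (UL = LR \<longrightarrow> (\<forall>i. UL = add_cell d i LL \<longrightarrow> UR = add_cell d (i + 1) UL))"

text \<open>Labelings are \<open>undefined\<close> outside the grid.\<close>

definition growth_diagrams :: "int \<Rightarrow> int \<Rightarrow> nat \<Rightarrow> nat \<Rightarrow> (nat \<times> nat \<Rightarrow> int \<Rightarrow> int) set" where
  "growth_diagrams d L m n =
    {G \<in> {0..m} \<times> {0..n} \<rightarrow>\<^sub>E shapes d L.
       (\<forall>x y. x < m \<and> y \<le> n \<longrightarrow> (\<exists>i. G (x + 1, y) = add_cell d i (G (x, y)))) \<and>
       (\<forall>x y. x \<le> m \<and> y < n \<longrightarrow> (\<exists>i. G (x, y + 1) = add_cell d i (G (x, y)))) \<and>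
       (\<forall>x y. x < m \<and> y < n \<longrightarrow>
          forward_rule d (G (x, y)) (G (x, y + 1)) (G (x + 1, y)) (G (x + 1, y + 1)))}"


section \<open>Finiteness of the sets that are counted or summed over\<close>

lemma shapes_period:
  assumes "lam \<in> shapes d L"
  shows "lam (i - k * d) = lam i + k * L"
proof -
  have step: "lam (r - d) = lam r + L" for r
  proof -
    have "\<forall>i. lam i = lam (i + d) + L" using assms unfolding shapes_def by blast
    from spec[OF this, of "r - d"] show ?thesis by simp
  qed
  show ?thesis
  proof (induction k rule: int_induct[where k = 0])
    case base
    show ?case by simp
  next
    case (step1 k)
    show ?case using step1 step[of "i - k * d"] by (simp add: algebra_simps)
  next
    case (step2 k)
    show ?case using step2 step[of "i - (k - 1) * d"] by (simp add: algebra_simps)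
  qed
qed

lemma mem_cell: "(a, b) \<in> cell d L i j \<longleftrightarrow> (\<exists>k. a = i - k * d \<and> b = j + k * L)"
  by (auto simp: cell_def)

lemma cell_shift: "cell d L (i - k * d) (j + k * L) = cell d L i j"
proof (intro set_eqI)
  fix x :: "int \<times> int"
  obtain a b where x: "x = (a, b)" by (cases x)
  have "(\<exists>l. a = i - k * d - l * d \<and> b = j + k * L + l * L) \<longleftrightarrow>
        (\<exists>l. a = i - l * d \<and> b = j + l * L)" (is "?A \<longleftrightarrow> ?B")
  proof
    assume ?A
    then obtain l where "a = i - k * d - l * d" "b = j + k * L + l * L" by blast
    then show ?B by (intro exI[of _ "k + l"]) (simp add: algebra_simps)
  next
    assume ?B
    then obtain l where "a = i - l * d" "b = j + l * L" by blast
    then show ?A by (intro exI[of _ "l - k"]) (simp add: algebra_simps)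
  qed
  then show "x \<in> cell d L (i - k * d) (j + k * L) \<longleftrightarrow> x \<in> cell d L i j"
    by (simp add: x mem_cell)
qed

lemma cell_eqD:
  assumes "cell d L i j = cell d L i' j'"
  shows "\<exists>k. i = i' - k * d \<and> j = j' + k * L"
proof -
  have "(i, j) \<in> cell d L i j" by (auto simp: mem_cell intro: exI[of _ 0])
  then show ?thesis using assms by (simp add: mem_cell)
qed

lemma cell_in_diagram_iff:
  assumes "lam \<in> shapes d L"
  shows "cell d L i j \<in> diagram d L lam \<longleftrightarrow> j \<le> lam i"
proof
  assume "cell d L i j \<in> diagram d L lam"
  then obtain i' j' where c: "cell d L i j = cell d L i' j'" "j' \<le> lam i'"
    unfolding diagram_def by blast
  then obtain k where "i = i' - k * d" "j = j' + k * L" by (blast dest: cell_eqD)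
  then show "j \<le> lam i" using c(2) shapes_period[OF assms, of i' k] by simp
qed (auto simp: diagram_def)

lemma representative_row:
  fixes d :: int
  assumes "1 \<le> d"
  shows "\<exists>k. i - k * d \<in> {1..d}"
proof -
  have "(i - 1) mod d = i - 1 - (i - 1) div d * d"
    by (simp add: minus_div_mult_eq_mod)
  moreover have "0 \<le> (i - 1) mod d" "(i - 1) mod d < d" using assms by auto
  ultimately show ?thesis by (intro exI[of _ "(i - 1) div d"]) auto
qed

lemma bij_betw_skew_diagram:
  assumes "1 \<le> d" "lam \<in> shapes d L" "mu \<in> shapes d L"
  shows "bij_betw (\<lambda>(i, j). cell d L i j) (SIGMA i:{1..d}. {mu i<..lam i}) (skew_diagram d L lam mu)"
  unfolding bij_betw_def
proof
  show "inj_on (\<lambda>(i, j). cell d L i j) (SIGMA i:{1..d}. {mu i<..lam i})"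
  proof (intro inj_onI, clarsimp)
    fix i j i' j'
    assume a: "1 \<le> i" "i \<le> d" "1 \<le> i'" "i' \<le> d" and "cell d L i j = cell d L i' j'"
    then obtain k where k: "i = i' - k * d" "j = j' + k * L" by (blast dest: cell_eqD)
    have "\<bar>k * d\<bar> < d" using a k by linarith
    then have "\<bar>k\<bar> * d < 1 * d" using assms(1) by (simp add: abs_mult)
    then have "\<bar>k\<bar> < 1" using assms(1) by (subst (asm) mult_less_cancel_right) auto
    then show "i = i' \<and> j = j'" using k by simp
  qed
next
  show "(\<lambda>(i, j). cell d L i j) ` (SIGMA i:{1..d}. {mu i<..lam i}) = skew_diagram d L lam mu"
  proof (intro equalityI subsetI)
    fix c assume "c \<in> skew_diagram d L lam mu"
    then obtain i j where c: "c = cell d L i j" "j \<le> lam i" "\<not> j \<le> mu i"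
      using cell_in_diagram_iff[OF assms(3)] by (auto simp: skew_diagram_def diagram_def)
    obtain k where k: "i - k * d \<in> {1..d}" using representative_row[OF assms(1)] by blast
    have "lam (i - k * d) = lam i + k * L" "mu (i - k * d) = mu i + k * L"
      by (rule shapes_period[OF assms(2)], rule shapes_period[OF assms(3)])
    then have "j + k * L \<in> {mu (i - k * d)<..lam (i - k * d)}" using c by simp
    with k have "(i - k * d, j + k * L) \<in> (SIGMA i:{1..d}. {mu i<..lam i})" by (rule SigmaI)
    moreover have "c = (\<lambda>(i, j). cell d L i j) (i - k * d, j + k * L)"
      by (simp only: c(1) cell_shift prod.case)
    ultimately show "c \<in> (\<lambda>(i, j). cell d L i j) ` (SIGMA i:{1..d}. {mu i<..lam i})"
      by (rule rev_image_eqI)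
  qed (auto simp: skew_diagram_def cell_in_diagram_iff assms)
qed

lemma finite_skew_diagram:
  assumes "1 \<le> d" "lam \<in> shapes d L" "mu \<in> shapes d L"
  shows "finite (skew_diagram d L lam mu)"
  using bij_betw_finite[OF bij_betw_skew_diagram[OF assms]] by simp

lemma card_skew_diagram:
  assumes "1 \<le> d" "lam \<in> shapes d L" "mu \<in> shapes d L" "mu \<le> lam"
  shows "int (card (skew_diagram d L lam mu)) = skew_size d lam mu"
proof -
  have "card (skew_diagram d L lam mu) = (\<Sum>i = 1..d. nat (lam i - mu i))"
    using bij_betw_same_card[OF bij_betw_skew_diagram[OF assms(1-3)]] by simp
  then show ?thesis using assms(4) by (simp add: skew_size_def le_fun_def)
qed

lemma finite_SCT:
  assumes "1 \<le> d" "lam \<in> shapes d L" "mu \<in> shapes d L"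
  shows "finite (SCT d L lam mu)"
proof (rule finite_subset)
  show "SCT d L lam mu \<subseteq> skew_diagram d L lam mu \<rightarrow>\<^sub>E {1..nat (skew_size d lam mu)}"
    unfolding SCT_def PiE_def by (auto dest: bij_betwE)
  show "finite (skew_diagram d L lam mu \<rightarrow>\<^sub>E {1..nat (skew_size d lam mu)})"
    by (intro finite_PiE finite_skew_diagram assms) auto
qed

lemma shapes_eqI:
  assumes "1 \<le> d" "lam \<in> shapes d L" "mu \<in> shapes d L" "\<And>i. i \<in> {1..d} \<Longrightarrow> lam i = mu i"
  shows "lam = mu"
proof
  fix i
  obtain k where "i - k * d \<in> {1..d}" using representative_row[OF assms(1)] by blast
  then have "lam (i - k * d) = mu (i - k * d)" by (rule assms(4))
  then show "lam i = mu i"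
    using shapes_period[OF assms(2), of i k] shapes_period[OF assms(3), of i k] by simp
qed

lemma finite_shapes_between:
  assumes "1 \<le> d"
  shows "finite {lam \<in> shapes d L. \<forall>i\<in>{1..d}. f i \<le> lam i \<and> lam i \<le> g i}" (is "finite ?S")
proof (rule inj_on_finite[where f = "\<lambda>lam. restrict lam {1..d}"])
  show "inj_on (\<lambda>lam. restrict lam {1..d}) ?S"
  proof (rule inj_onI)
    fix lam mu assume "lam \<in> ?S" "mu \<in> ?S" and eq: "restrict lam {1..d} = restrict mu {1..d}"
    then have "lam \<in> shapes d L" "mu \<in> shapes d L" by simp_all
    moreover have "lam i = mu i" if "i \<in> {1..d}" for i
      using fun_cong[OF eq, of i] that by simp
    ultimately show "lam = mu" by (rule shapes_eqI[OF assms])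
  qed
  show "(\<lambda>lam. restrict lam {1..d}) ` ?S \<subseteq> (\<Pi>\<^sub>E i\<in>{1..d}. {f i..g i})" by auto
  show "finite (\<Pi>\<^sub>E i\<in>{1..d}. {f i..g i})" by (intro finite_PiE) auto
qed

lemma skew_size_bound:
  assumes "mu \<le> lam" "i \<in> {1..d}"
  shows "lam i - mu i \<le> skew_size d lam mu"
  unfolding skew_size_def using assms by (intro member_le_sum) (auto simp: le_fun_def)

lemma finite_common_subshapes:
  assumes "1 \<le> d"
  shows "finite {mu \<in> shapes d L. mu \<le> al \<and> mu \<le> be \<and> skew_size d al mu = N \<and> skew_size d be mu = M}"
    (is "finite ?A")
proof (rule finite_subset)
  show "?A \<subseteq> {mu \<in> shapes d L. \<forall>i\<in>{1..d}. al i - N \<le> mu i \<and> mu i \<le> al i}"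
  proof (intro subsetI CollectI conjI ballI)
    fix mu i assume mu: "mu \<in> ?A" and i: "i \<in> {1..d}"
    show "al i - N \<le> mu i" "mu i \<le> al i"
      using mu i skew_size_bound[of mu al i d] by (auto simp: le_fun_def)
  qed simp
qed (rule finite_shapes_between[OF assms])

lemma finite_common_supershapes:
  assumes "1 \<le> d"
  shows "finite {lam \<in> shapes d L. al \<le> lam \<and> be \<le> lam \<and> skew_size d lam be = N \<and> skew_size d lam al = M}"
    (is "finite ?A")
proof (rule finite_subset)
  show "?A \<subseteq> {lam \<in> shapes d L. \<forall>i\<in>{1..d}. be i \<le> lam i \<and> lam i \<le> be i + N}"
  proof (intro subsetI CollectI conjI ballI)
    fix lam i assume lam: "lam \<in> ?A" and i: "i \<in> {1..d}"
    show "be i \<le> lam i" "lam i \<le> be i + N"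
      using lam i skew_size_bound[of be lam i d] by (auto simp: le_fun_def)
  qed simp
qed (rule finite_shapes_between[OF assms])

lemma OCT_bound:
  assumes "rs \<in> OCT d L w al be" "k \<le> length w"
  shows "\<bar>(rs ! k) i - al i\<bar> \<le> int k"
  using assms(2)
proof (induction k)
  case 0
  then show ?case using assms(1) by (simp add: OCT_def)
next
  case (Suc k)
  then have "sign_step d (w ! k) (rs ! k) (rs ! (k + 1))" using assms(1) by (simp add: OCT_def)
  then have "\<bar>(rs ! Suc k) i - (rs ! k) i\<bar> \<le> 1"
    by (cases "w ! k") (auto simp: add_cell_def remove_cell_def)
  moreover have "\<bar>(rs ! k) i - al i\<bar> \<le> int k" using Suc by simp
  ultimately show ?case by simp
qed

lemma finite_OCT:
  assumes "1 \<le> d"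
  shows "finite (OCT d L w al be)"
proof (rule finite_subset)
  let ?N = "int (length w)"
  let ?S = "{lam \<in> shapes d L. \<forall>i\<in>{1..d}. al i - ?N \<le> lam i \<and> lam i \<le> al i + ?N}"
  show "OCT d L w al be \<subseteq> {rs. set rs \<subseteq> ?S \<and> length rs = length w + 1}"
  proof
    fix rs assume rs: "rs \<in> OCT d L w al be"
    then have len: "length rs = length w + 1" and sh: "set rs \<subseteq> shapes d L"
      by (simp_all add: OCT_def)
    have "rs ! k \<in> ?S" if "k < length rs" for k
    proof -
      have "k \<le> length w" using that len by simp
      then have "al i - ?N \<le> (rs ! k) i \<and> (rs ! k) i \<le> al i + ?N" for i
        using OCT_bound[OF rs, of k i] by linarith
      moreover have "rs ! k \<in> shapes d L" using that sh nth_mem by blast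
      ultimately show ?thesis by blast
    qed
    then have "set rs \<subseteq> ?S" by (auto simp only: in_set_conv_nth subset_iff)
    then show "rs \<in> {rs. set rs \<subseteq> ?S \<and> length rs = length w + 1}" using len by blast
  qed
  show "finite {rs. set rs \<subseteq> ?S \<and> length rs = length w + 1}"
    by (rule finite_lists_length_eq[OF finite_shapes_between[OF assms]])
qed

end

theory Submission
  imports Defs
begin

text \<open>Only finite sets are involved, so everything is a matter of counting, and all counts are reduced
  to the cardinalities of sets of walks \<open>OCT d L w al be\<close>.

  The heart is that the forward local rule is invertible. Fix the labels \<open>UL\<close> and \<open>LR\<close> of a unit
  square. If they are different and have a common neighbour below, obtained by removing a cell from
  each, then they differ from it in different rows \<open>i\<close> and \<open>j\<close>, the neighbour is the pointwise
  minimum, and the pointwise maximum is the unique common neighbour above; the same holds upside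
  down. If they are equal, the neighbours below correspond to the rows \<open>i\<close> from which a cell can be
  removed, that is, to the strict descents \<open>UL (i + 1) < UL i\<close>, and the neighbours above to the rows
  to which a cell can be added. The same strict descent is what allows a cell to be added in row
  \<open>i + 1\<close>. On the cylinder there is no first row, so the shift from \<open>i\<close> to \<open>i + 1\<close> matches the two
  sets of rows perfectly. Hence there are as many common neighbours above as below
  (\<open>card_below_eq_card_above\<close>), which says that the words \<open>+-\<close> and \<open>-+\<close> admit equally many walks between
  any two shapes.

  The count of walks along a concatenation of words is a matrix product (\<open>card_OCT_append\<close>).
  Therefore equality of counts survives prepending and appending letters, and sorting a word by
  swapping adjacent letters shows that the count depends only on the numbers of pluses and minuses
  (\<open>equinumerous_words_sort\<close>).

  The three parts of the theorem are now obtained from special words. For \<open>-\<close> repeated \<open>n\<close> times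
  followed by \<open>+\<close> repeated \<open>m\<close> times, walks are the same as labelings of the left column and the
  bottom row of the grid, and such a labeling extends to a growth diagram uniquely, one square at a
  time (\<open>bij_betw_corner_path\<close>). Splitting the same walks at the lowest shape \<open>mu\<close> gives the first
  sum, and splitting the walks of the opposite word at the highest shape \<open>lam\<close> gives the second,
  since walks that only add cells are equinumerous with standard tableaux: both satisfy the
  recursion that removes the last cell (\<open>card_SCT_eq_OCT\<close>).\<close>

section \<open>Adding and removing cells\<close>

lemma shapes_iff:
  "lam \<in> shapes d L \<longleftrightarrow> (\<forall>i. lam (i + 1) \<le> lam i) \<and> (\<forall>i. lam i = lam (i + d) + L)"
proof -
  have "antimono lam \<longleftrightarrow> (\<forall>i. lam (i + 1) \<le> lam i)" for lam :: "int \<Rightarrow> int"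
  proof
    assume step: "\<forall>i. lam (i + 1) \<le> lam i"
    show "antimono lam"
    proof (rule antimonoI)
      fix x y :: int assume "x \<le> y"
      then show "lam y \<le> lam x"
      proof (induction y rule: int_ge_induct)
        case (step i)
        then show ?case using \<open>\<forall>i. lam (i + 1) \<le> lam i\<close> order_trans by blast
      qed simp
    qed
  qed (simp add: antimono_def)
  then show ?thesis by (simp add: shapes_def)
qed

lemma shapes_step: "lam \<in> shapes d L \<Longrightarrow> lam (i + 1) \<le> lam i"
  unfolding shapes_iff by blast

lemma shapes_shift: "lam \<in> shapes d L \<Longrightarrow> lam i = lam (i + d) + L"
  unfolding shapes_iff by blast

lemma add_remove_cell [simp]:
  "add_cell d i (remove_cell d i lam) = lam" "remove_cell d i (add_cell d i lam) = lam"
  by (auto simp: add_cell_def remove_cell_def)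

lemma sign_step_Minus_iff: "sign_step d Minus lam mu \<longleftrightarrow> (\<exists>i. lam = add_cell d i mu)"
  by (metis add_remove_cell sign_step.simps(2))

lemma add_cell_cong: "d dvd i - j \<Longrightarrow> add_cell d i lam = add_cell d j lam"
  for d :: int
proof -
  assume "d dvd i - j"
  then have "d dvd r - i \<longleftrightarrow> d dvd r - j" for r
    using dvd_add_right_iff[of d "i - j" "r - i"] by simp
  then show ?thesis by (simp add: add_cell_def)
qed

lemma add_cell_eq_iff: "add_cell d i lam = add_cell d j lam \<longleftrightarrow> d dvd i - j"
proof
  assume "add_cell d i lam = add_cell d j lam"
  from fun_cong[OF this, of i] show "d dvd i - j" by (simp add: add_cell_def split: if_splits)
qed (rule add_cell_cong)

lemma add_cell_cancel [simp]: "add_cell d i lam = add_cell d i mu \<longleftrightarrow> lam = mu"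
  by (metis add_remove_cell(2))

lemma shapes_row_cong:
  assumes "lam \<in> shapes d L" and "d dvd r - i"
  obtains k where "\<And>s. lam (r + s) = lam (i + s) + k * L"
proof -
  obtain k where "r - i = d * k" using assms(2) by blast
  then have "r + s = (i + s) - (- k) * d" for s by (simp add: algebra_simps)
  then show thesis using that[of "-k"] shapes_period[OF assms(1)] by metis
qed

text \<open>By periodicity only the two inequalities next to row \<open>i\<close> matter, and of these only the one with
  row \<open>i - 1\<close> can fail. For \<open>d = 1\<close> all rows are the same row, every shape admits a new cell, and the
  right-hand side agrees because consecutive parts differ by \<open>L\<close>, which is positive.\<close>

lemma add_cell_in_shapes_iff:
  assumes "1 \<le> d" "1 \<le> L" and lam: "lam \<in> shapes d L"
  shows "add_cell d i lam \<in> shapes d L \<longleftrightarrow> lam i < lam (i - 1)"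
proof -
  have per: "add_cell d i lam r = add_cell d i lam (r + d) + L" for r
  proof -
    have "d dvd r - i \<longleftrightarrow> d dvd (r + d) - i"
      using dvd_add_right_iff[of d d "r - i"] by (simp add: algebra_simps)
    then show ?thesis using shapes_shift[OF lam, of r] by (simp add: add_cell_def)
  qed
  have mono: "lam (r + 1) \<le> lam r" for r using lam by (rule shapes_step)
  have one: "lam i < lam (i - 1)" if "d = 1"
    using shapes_period[OF lam, of i 1] that \<open>1 \<le> L\<close> by simp
  show ?thesis
  proof
    assume "add_cell d i lam \<in> shapes d L"
    then have "add_cell d i lam (i - 1 + 1) \<le> add_cell d i lam (i - 1)"
      unfolding shapes_iff by blast
    moreover have "d = 1" if "d dvd -1" using that \<open>1 \<le> d\<close> by simp
    ultimately show "lam i < lam (i - 1)" using one by (auto simp: add_cell_def split: if_splits)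
  next
    assume lt: "lam i < lam (i - 1)"
    have "add_cell d i lam (r + 1) \<le> add_cell d i lam r" for r
    proof (cases "d dvd r + 1 - i")
      case True
      then obtain k where "\<And>s. lam (r + 1 + s) = lam (i + s) + k * L"
        using shapes_row_cong[OF lam] by blast
      from this[of 0] this[of "-1"] show ?thesis using lt by (simp add: add_cell_def)
    qed (use mono[of r] in \<open>simp add: add_cell_def\<close>)
    then show "add_cell d i lam \<in> shapes d L" using per unfolding shapes_iff by blast
  qed
qed

lemma remove_cell_in_shapes_iff:
  assumes "1 \<le> d" "1 \<le> L" and lam: "lam \<in> shapes d L"
  shows "remove_cell d i lam \<in> shapes d L \<longleftrightarrow> lam (i + 1) < lam i"
proof -
  have per: "remove_cell d i lam r = remove_cell d i lam (r + d) + L" for r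
  proof -
    have "d dvd r - i \<longleftrightarrow> d dvd (r + d) - i"
      using dvd_add_right_iff[of d d "r - i"] by (simp add: algebra_simps)
    then show ?thesis using shapes_shift[OF lam, of r] by (simp add: remove_cell_def)
  qed
  have mono: "lam (r + 1) \<le> lam r" for r using lam by (rule shapes_step)
  have one: "lam (i + 1) < lam i" if "d = 1"
    using shapes_period[OF lam, of "i + 1" 1] that \<open>1 \<le> L\<close> by simp
  show ?thesis
  proof
    assume "remove_cell d i lam \<in> shapes d L"
    then have "remove_cell d i lam (i + 1) \<le> remove_cell d i lam i"
      unfolding shapes_iff by blast
    moreover have "d = 1" if "d dvd 1" using that \<open>1 \<le> d\<close> by simp
    ultimately show "lam (i + 1) < lam i" using one by (auto simp: remove_cell_def split: if_splits)
  next
    assume lt: "lam (i + 1) < lam i"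
    have "remove_cell d i lam (r + 1) \<le> remove_cell d i lam r" for r
    proof (cases "d dvd r - i")
      case True
      then obtain k where "\<And>s. lam (r + s) = lam (i + s) + k * L"
        using shapes_row_cong[OF lam] by blast
      from this[of 0] this[of 1] show ?thesis using lt by (simp add: remove_cell_def)
    qed (use mono[of r] in \<open>simp add: remove_cell_def\<close>)
    then show "remove_cell d i lam \<in> shapes d L" using per unfolding shapes_iff by blast
  qed
qed

lemma max_in_shapes:
  assumes "lam \<in> shapes d L" "mu \<in> shapes d L"
  shows "(\<lambda>i. max (lam i) (mu i)) \<in> shapes d L"
  using assms unfolding shapes_iff by (metis max.mono max_add_distrib_left)

lemma min_in_shapes:
  assumes "lam \<in> shapes d L" "mu \<in> shapes d L"
  shows "(\<lambda>i. min (lam i) (mu i)) \<in> shapes d L"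
  using assms unfolding shapes_iff by (metis min.mono min_add_distrib_left)

section \<open>Invertibility of the local rule\<close>

definition below :: "int \<Rightarrow> int \<Rightarrow> (int \<Rightarrow> int) \<Rightarrow> (int \<Rightarrow> int) \<Rightarrow> (int \<Rightarrow> int) set" where
  "below d L lam mu = {nu \<in> shapes d L. (\<exists>i. lam = add_cell d i nu) \<and> (\<exists>j. mu = add_cell d j nu)}"

definition above :: "int \<Rightarrow> int \<Rightarrow> (int \<Rightarrow> int) \<Rightarrow> (int \<Rightarrow> int) \<Rightarrow> (int \<Rightarrow> int) set" where
  "above d L lam mu = {nu \<in> shapes d L. (\<exists>i. nu = add_cell d i lam) \<and> (\<exists>j. nu = add_cell d j mu)}"

text \<open>For different labels \<open>lam\<close> and \<open>mu\<close> the new label is their pointwise maximum, which arises from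
  either of them by adding the cell of the other. For equal labels a cell was added in row \<open>i\<close>; taking
  it away again leaves a shape, so row \<open>i\<close> is strictly longer than row \<open>i + 1\<close>, and the latter can
  receive a cell.\<close>

lemma forward_ex1_above:
  assumes "1 \<le> d" "1 \<le> L" "lam \<in> shapes d L" "mu \<in> shapes d L" and nu: "nu \<in> below d L lam mu"
  shows "\<exists>!ka. ka \<in> above d L lam mu \<and> forward_rule d nu lam mu ka"
proof -
  obtain i j where ij: "lam = add_cell d i nu" "mu = add_cell d j nu" and "nu \<in> shapes d L"
    using nu unfolding below_def by blast
  show ?thesis
  proof (cases "lam = mu")
    case False
    have "\<not> d dvd i - j" using False ij by (simp add: add_cell_eq_iff)
    then have excl: "\<not> (d dvd r - i \<and> d dvd r - j)" for r
      using dvd_diff[of d "r - j" "r - i"] by auto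
    let ?m = "\<lambda>i. max (lam i) (mu i)"
    have "?m = add_cell d j lam" "?m = add_cell d i mu"
      using excl unfolding ij by (auto simp: fun_eq_iff add_cell_def)
    then have "?m \<in> above d L lam mu"
      using max_in_shapes[OF assms(3,4)] unfolding above_def by blast
    then show ?thesis using False by (intro ex1I[of _ ?m]) (auto simp: forward_rule_def)
  next
    case True
    let ?k = "add_cell d (i + 1) lam"
    have rm: "nu = remove_cell d i lam" by (simp add: ij)
    have "lam (i + 1) < lam i"
      using \<open>nu \<in> shapes d L\<close> remove_cell_in_shapes_iff[OF assms(1-3), of i] rm by simp
    then have "?k \<in> shapes d L"
      using add_cell_in_shapes_iff[OF assms(1-3), of "i + 1"] by simp
    then have "?k \<in> above d L lam mu" unfolding above_def using True by blast
    moreover have "add_cell d (i' + 1) lam = ?k" if "lam = add_cell d i' nu" for i'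
      using that ij(1) add_cell_eq_iff[of d i nu i'] by (simp add: add_cell_eq_iff dvd_diff_commute)
    ultimately show ?thesis using True ij(1)
      by (intro ex1I[of _ ?k]) (auto simp: forward_rule_def)
  qed
qed

text \<open>The same argument upside down, with the pointwise minimum and with row \<open>i - 1\<close>. The
  uniqueness has a different reason: here the rule constrains \<open>nu\<close> only through the row in which
  \<open>lam\<close> extends it, and for different labels every common lower neighbour is their minimum.\<close>

lemma forward_ex1_below:
  assumes "1 \<le> d" "1 \<le> L" "lam \<in> shapes d L" "mu \<in> shapes d L" and ka: "ka \<in> above d L lam mu"
  shows "\<exists>!nu. nu \<in> below d L lam mu \<and> forward_rule d nu lam mu ka"
proof -
  obtain i j where ij: "ka = add_cell d i lam" "ka = add_cell d j mu" and "ka \<in> shapes d L"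
    using ka unfolding above_def by blast
  have ij': "lam = remove_cell d i ka" by (simp add: ij(1))
  have "mu = remove_cell d j ka" by (simp add: ij(2))
  note ij' = ij' this
  show ?thesis
  proof (cases "lam = mu")
    case False
    have "\<not> d dvd i - j"
    proof
      assume "d dvd i - j"
      then have "add_cell d j lam = add_cell d j mu" using ij add_cell_cong[of d i j lam] by simp
      then show False using False by simp
    qed
    then have excl: "\<not> (d dvd r - i \<and> d dvd r - j)" for r
      using dvd_diff[of d "r - j" "r - i"] by auto
    let ?m = "\<lambda>i. min (lam i) (mu i)"
    have "lam = add_cell d j ?m" "mu = add_cell d i ?m"
      using excl unfolding ij' by (auto simp: fun_eq_iff add_cell_def remove_cell_def)
    then have m: "?m \<in> below d L lam mu"
      using min_in_shapes[OF assms(3,4)] unfolding below_def by blast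
    have "ka = (\<lambda>i. max (lam i) (mu i))"
      using excl unfolding ij' by (auto simp: fun_eq_iff remove_cell_def)
    then have "forward_rule d ?m lam mu ka" using False by (simp add: forward_rule_def)
    moreover have "nu = ?m" if nu: "nu \<in> below d L lam mu" for nu
    proof -
      obtain i' j' where n: "lam = add_cell d i' nu" "mu = add_cell d j' nu"
        using nu unfolding below_def by blast
      then have "\<not> d dvd i' - j'" using False by (simp add: add_cell_eq_iff)
      then have "\<not> (d dvd r - i' \<and> d dvd r - j')" for r
        using dvd_diff[of d "r - j'" "r - i'"] by auto
      then show ?thesis unfolding n by (auto simp: fun_eq_iff add_cell_def)
    qed
    ultimately show ?thesis using m by blast
  next
    case True
    let ?n = "remove_cell d (i - 1) lam"
    have "lam i < lam (i - 1)"
      using \<open>ka \<in> shapes d L\<close> add_cell_in_shapes_iff[OF assms(1-3), of i] ij by simp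
    then have "?n \<in> shapes d L"
      using remove_cell_in_shapes_iff[OF assms(1-3), of "i - 1"] by simp
    then have n: "?n \<in> below d L lam mu" using True unfolding below_def by (auto intro!: exI[of _ "i - 1"])
    have "forward_rule d ?n lam mu ka"
    proof -
      have "add_cell d (i' + 1) lam = ka" if "lam = add_cell d i' ?n" for i'
      proof -
        have "add_cell d i' ?n = add_cell d (i - 1) ?n" using that by simp
        then have "d dvd i' - (i - 1)" by (simp only: add_cell_eq_iff)
        then show ?thesis unfolding ij(1) by (simp add: add_cell_eq_iff algebra_simps)
      qed
      then show ?thesis using True by (auto simp: forward_rule_def)
    qed
    moreover have "nu = ?n" if "nu \<in> below d L lam mu" "forward_rule d nu lam mu ka" for nu
    proof -
      obtain i' where i': "lam = add_cell d i' nu" using \<open>nu \<in> below d L lam mu\<close> unfolding below_def by blast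
      then have "ka = add_cell d (i' + 1) lam" using that(2) True unfolding forward_rule_def by blast
      then have "d dvd (i' + 1) - i" using ij(1) by (metis add_cell_eq_iff)
      then have "lam = add_cell d (i - 1) nu"
        using i' add_cell_cong[of d i' "i - 1" nu] by (simp add: algebra_simps)
      then show ?thesis by simp
    qed
    ultimately show ?thesis using n by blast
  qed
qed

lemma card_eq_if_unique_match:
  assumes "\<And>a. a \<in> A \<Longrightarrow> \<exists>!b. b \<in> B \<and> R a b" and "\<And>b. b \<in> B \<Longrightarrow> \<exists>!a. a \<in> A \<and> R a b"
  shows "card A = card B"
proof (rule bij_betw_same_card)
  let ?f = "\<lambda>a. THE b. b \<in> B \<and> R a b"
  have f: "?f a \<in> B \<and> R a (?f a)" if "a \<in> A" for a using theI'[OF assms(1)[OF that]] .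
  show "bij_betw ?f A B"
    unfolding bij_betw_def inj_on_def
  proof (intro conjI ballI impI equalityI subsetI)
    fix b assume "b \<in> B"
    then obtain a where a: "a \<in> A" "R a b" using assms(2) by blast
    then have "b = ?f a" using assms(1)[OF a(1)] f[OF a(1)] \<open>b \<in> B\<close> by blast
    then show "b \<in> ?f ` A" using a(1) by blast
  next
    fix a a' assume "a \<in> A" "a' \<in> A" "?f a = ?f a'"
    then show "a = a'" using f assms(2) by metis
  qed (use f in auto)
qed

lemma card_below_eq_card_above:
  assumes "1 \<le> d" "1 \<le> L" "lam \<in> shapes d L" "mu \<in> shapes d L"
  shows "card (below d L lam mu) = card (above d L lam mu)"
  by (rule card_eq_if_unique_match[where R = "\<lambda>nu ka. forward_rule d nu lam mu ka"])
     (rule forward_ex1_above[OF assms] forward_ex1_below[OF assms]; assumption)+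

section \<open>Counting walks\<close>

lemma OCT_iff:
  "rs \<in> OCT d L w al be \<longleftrightarrow> length rs = length w + 1 \<and> (\<forall>k \<le> length w. rs ! k \<in> shapes d L) \<and>
     rs ! 0 = al \<and> rs ! length w = be \<and>
     (\<forall>k < length w. sign_step d (w ! k) (rs ! k) (rs ! Suc k))"
proof -
  have "set rs \<subseteq> shapes d L \<longleftrightarrow> (\<forall>k < length rs. rs ! k \<in> shapes d L)"
    by (simp add: subset_eq all_set_conv_all_nth)
  then show ?thesis by (auto simp: OCT_def less_Suc_eq_le)
qed

lemma OCT_endpoints: "OCT d L w al be \<noteq> {} \<Longrightarrow> al \<in> shapes d L \<and> be \<in> shapes d L"
  by (auto simp: OCT_iff)

lemma OCT_append_split:
  assumes "rs \<in> OCT d L (u @ v) al be"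
  shows "take (Suc (length u)) rs \<in> OCT d L u al (rs ! length u)"
    and "drop (length u) rs \<in> OCT d L v (rs ! length u) be"
proof -
  have r: "length rs = length u + length v + 1" "\<forall>k \<le> length u + length v. rs ! k \<in> shapes d L"
    "rs ! 0 = al" "rs ! (length u + length v) = be"
    "\<forall>k < length u + length v. sign_step d ((u @ v) ! k) (rs ! k) (rs ! Suc k)"
    using assms by (auto simp: OCT_iff)
  show "take (Suc (length u)) rs \<in> OCT d L u al (rs ! length u)"
  proof -
    have "sign_step d (u ! k) (rs ! k) (rs ! Suc k)" if "k < length u" for k
      using r(5)[rule_format, of k] that by (simp add: nth_append)
    then show ?thesis using r by (auto simp: OCT_iff)
  qed
  show "drop (length u) rs \<in> OCT d L v (rs ! length u) be"
  proof -
    have "sign_step d (v ! k) (rs ! (length u + k)) (rs ! Suc (length u + k))" if "k < length v" for k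
      using r(5)[rule_format, of "length u + k"] that by (simp add: nth_append)
    then show ?thesis using r by (auto simp: OCT_iff)
  qed
qed

lemma OCT_append_join:
  assumes p: "p \<in> OCT d L u al mu" and q: "q \<in> OCT d L v mu be"
  shows "p @ tl q \<in> OCT d L (u @ v) al be"
proof -
  have len: "length p = Suc (length u)" "length q = Suc (length v)" using p q by (auto simp: OCT_iff)
  have left: "(p @ tl q) ! k = p ! k" if "k \<le> length u" for k
    using that len by (simp add: nth_append)
  have right: "(p @ tl q) ! (length u + k) = q ! k" if "k \<le> length v" for k
  proof (cases k)
    case 0
    then show ?thesis using p q len by (simp add: OCT_iff nth_append)
  next
    case (Suc l)
    then show ?thesis using that len by (simp add: nth_append nth_tl)
  qed
  have split: "k \<le> length u \<or> (\<exists>l. k = length u + l \<and> l \<le> length v)" if "k \<le> length u + length v" for k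
    using that by presburger
  have "(p @ tl q) ! k \<in> shapes d L" if "k \<le> length u + length v" for k
    using split[OF that] left right p q by (auto simp: OCT_iff)
  moreover have "sign_step d ((u @ v) ! k) ((p @ tl q) ! k) ((p @ tl q) ! Suc k)" if "k < length u + length v" for k
  proof (cases "k < length u")
    case True
    then show ?thesis using p left[of k] left[of "Suc k"] by (simp add: OCT_iff nth_append[of u])
  next
    case False
    define l where "l = k - length u"
    have l: "k = length u + l" "l < length v" using False that by (auto simp: l_def)
    then show ?thesis using q right[of l] right[of "Suc l"] by (simp add: OCT_iff)
  qed
  moreover have "(p @ tl q) ! 0 = al" using left[of 0] p by (simp add: OCT_iff)
  moreover have "(p @ tl q) ! (length u + length v) = be" using right[of "length v"] q by (simp add: OCT_iff)
  ultimately show ?thesis using len by (simp add: OCT_iff)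
qed

text \<open>Cutting a walk at the junction of the two words turns counts into a product of matrices. The
  set \<open>S\<close> stands for the middle shapes that can occur; leaving it a parameter allows the sums of the
  theorem to be obtained directly over their own index sets.\<close>

lemma card_OCT_append:
  assumes "1 \<le> d" "finite S"
    and supp: "\<And>mu. OCT d L u al mu \<noteq> {} \<Longrightarrow> OCT d L v mu be \<noteq> {} \<Longrightarrow> mu \<in> S"
  shows "card (OCT d L (u @ v) al be) = (\<Sum>mu\<in>S. card (OCT d L u al mu) * card (OCT d L v mu be))"
proof -
  let ?n = "length u"
  have "bij_betw (\<lambda>rs. (rs ! ?n, take (Suc ?n) rs, drop ?n rs)) (OCT d L (u @ v) al be)
     (SIGMA mu:S. OCT d L u al mu \<times> OCT d L v mu be)"
  proof (rule bij_betw_byWitness[where f' = "\<lambda>(mu, p, q). p @ tl q"])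
    show "\<forall>rs\<in>OCT d L (u @ v) al be. (case (rs ! ?n, take (Suc ?n) rs, drop ?n rs) of (mu, p, q) \<Rightarrow> p @ tl q) = rs"
      by (auto simp: tl_drop drop_Suc[symmetric])
    show "\<forall>x\<in>SIGMA mu:S. OCT d L u al mu \<times> OCT d L v mu be.
       ((case x of (mu, p, q) \<Rightarrow> p @ tl q) ! ?n, take (Suc ?n) (case x of (mu, p, q) \<Rightarrow> p @ tl q),
        drop ?n (case x of (mu, p, q) \<Rightarrow> p @ tl q)) = x"
    proof
      fix x assume "x \<in> (SIGMA mu:S. OCT d L u al mu \<times> OCT d L v mu be)"
      then obtain mu p q where x: "x = (mu, p, q)" and p: "p \<in> OCT d L u al mu" and q: "q \<in> OCT d L v mu be"
        by blast
      from p q have len: "length p = Suc ?n" "length q = Suc (length v)" "p ! ?n = mu" "q ! 0 = mu"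
        by (auto simp: OCT_iff)
      obtain p' where p': "p = p' @ [mu]" "length p' = ?n"
        using len by (metis append_butlast_last_id diff_Suc_1 last_conv_nth length_0_conv length_butlast nat.distinct(1))
      obtain q' where q': "q = mu # q'" using len by (cases q) auto
      show "((case x of (mu, p, q) \<Rightarrow> p @ tl q) ! ?n, take (Suc ?n) (case x of (mu, p, q) \<Rightarrow> p @ tl q),
        drop ?n (case x of (mu, p, q) \<Rightarrow> p @ tl q)) = x"
        unfolding x p'(1) q' using p'(2) by (simp add: nth_append)
    qed
    show "(\<lambda>rs. (rs ! ?n, take (Suc ?n) rs, drop ?n rs)) ` OCT d L (u @ v) al be
      \<subseteq> (SIGMA mu:S. OCT d L u al mu \<times> OCT d L v mu be)"
    proof (rule image_subsetI)
      fix rs assume "rs \<in> OCT d L (u @ v) al be"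
      note OCT_append_split[OF this]
      moreover from this have "rs ! ?n \<in> S" by (intro supp) blast+
      ultimately show "(rs ! ?n, take (Suc ?n) rs, drop ?n rs) \<in> (SIGMA mu:S. OCT d L u al mu \<times> OCT d L v mu be)"
        by blast
    qed
    show "(\<lambda>(mu, p, q). p @ tl q) ` (SIGMA mu:S. OCT d L u al mu \<times> OCT d L v mu be)
      \<subseteq> OCT d L (u @ v) al be"
      by (auto intro: OCT_append_join)
  qed
  then have "card (OCT d L (u @ v) al be) = card (SIGMA mu:S. OCT d L u al mu \<times> OCT d L v mu be)"
    by (rule bij_betw_same_card)
  also have "\<dots> = (\<Sum>mu\<in>S. card (OCT d L u al mu \<times> OCT d L v mu be))"
    using \<open>finite S\<close> finite_OCT[OF \<open>1 \<le> d\<close>] by (intro card_SigmaI) auto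
  finally show ?thesis by (simp add: card_cartesian_product)
qed

lemma finite_reachable:
  assumes "1 \<le> d"
  shows "finite {mu. OCT d L w al mu \<noteq> {}}"
proof (rule finite_subset)
  show "{mu. OCT d L w al mu \<noteq> {}} \<subseteq>
    {lam \<in> shapes d L. \<forall>i\<in>{1..d}. al i - int (length w) \<le> lam i \<and> lam i \<le> al i + int (length w)}"
  proof (intro subsetI CollectI)
    fix mu assume "mu \<in> {mu. OCT d L w al mu \<noteq> {}}"
    then obtain rs where rs: "rs \<in> OCT d L w al mu" by blast
    have "mu \<in> shapes d L" "rs ! length w = mu" using rs by (auto simp: OCT_iff)
    then show "mu \<in> shapes d L \<and> (\<forall>i\<in>{1..d}. al i - int (length w) \<le> mu i \<and> mu i \<le> al i + int (length w))"
      using OCT_bound[OF rs le_refl] by (simp add: abs_le_iff algebra_simps)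
  qed
qed (rule finite_shapes_between[OF assms])

definition equinumerous_words :: "int \<Rightarrow> int \<Rightarrow> sign list \<Rightarrow> sign list \<Rightarrow> bool" where
  "equinumerous_words d L u v \<longleftrightarrow> (\<forall>al be. card (OCT d L u al be) = card (OCT d L v al be))"

lemma equinumerous_words_append:
  assumes "1 \<le> d" "equinumerous_words d L u u'" "equinumerous_words d L v v'"
  shows "equinumerous_words d L (u @ v) (u' @ v')"
  unfolding equinumerous_words_def
proof (intro allI)
  fix al be
  let ?S = "{mu. OCT d L u al mu \<noteq> {}}"
  have "OCT d L u al mu = {} \<longleftrightarrow> OCT d L u' al mu = {}" for mu
    using assms(2) finite_OCT[OF assms(1)] unfolding equinumerous_words_def by (metis card_0_eq)
  then have "card (OCT d L (u' @ v') al be) = (\<Sum>mu\<in>?S. card (OCT d L u' al mu) * card (OCT d L v' mu be))"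
    by (intro card_OCT_append assms(1) finite_reachable) simp
  moreover have "card (OCT d L (u @ v) al be) = (\<Sum>mu\<in>?S. card (OCT d L u al mu) * card (OCT d L v mu be))"
    by (intro card_OCT_append assms(1) finite_reachable) simp
  ultimately show "card (OCT d L (u @ v) al be) = card (OCT d L (u' @ v') al be)"
    using assms(2,3) by (simp add: equinumerous_words_def)
qed

lemma OCT_two_steps:
  "OCT d L [s, t] al be = (if al \<in> shapes d L \<and> be \<in> shapes d L then
     (\<lambda>nu. [al, nu, be]) ` {nu \<in> shapes d L. sign_step d s al nu \<and> sign_step d t nu be} else {})"
proof -
  have "rs \<in> OCT d L [s, t] al be \<longleftrightarrow> al \<in> shapes d L \<and> be \<in> shapes d L \<and>
     (\<exists>nu \<in> shapes d L. rs = [al, nu, be] \<and> sign_step d s al nu \<and> sign_step d t nu be)" for rs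
    by (auto simp: OCT_def less_Suc_eq numeral_3_eq_3 length_Suc_conv)
  then show ?thesis by (auto split: if_splits)
qed

text \<open>The two walks around a unit square: one passes through its upper corner, the other through its
  lower corner.\<close>

lemma Plus_Minus_commute:
  assumes "1 \<le> d" "1 \<le> L"
  shows "equinumerous_words d L [Plus, Minus] [Minus, Plus]"
  unfolding equinumerous_words_def
proof (intro allI)
  fix al be :: "int \<Rightarrow> int"
  have inj: "inj_on (\<lambda>nu. [al, nu, be]) X" for X by (simp add: inj_on_def)
  show "card (OCT d L [Plus, Minus] al be) = card (OCT d L [Minus, Plus] al be)"
  proof (cases "al \<in> shapes d L \<and> be \<in> shapes d L")
    case True
    then have "card (OCT d L [Plus, Minus] al be) = card (above d L al be)"
      by (simp add: OCT_two_steps card_image[OF inj] above_def sign_step_Minus_iff del: sign_step.simps(2))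
    moreover have "card (OCT d L [Minus, Plus] al be) = card (below d L al be)"
      using True
      by (simp add: OCT_two_steps card_image[OF inj] below_def sign_step_Minus_iff del: sign_step.simps(2))
    ultimately show ?thesis using True card_below_eq_card_above[OF assms] by simp
  qed (auto simp: OCT_two_steps)
qed

text \<open>Words with equally many letters of each sign have the same sorted form. A single plus moves past
  a block of minuses by adjacent swaps (\<open>move\<close>), which is the step of an insertion sort.\<close>

lemma equinumerous_words_sort:
  assumes "1 \<le> d" "1 \<le> L"
  shows "equinumerous_words d L w (replicate (count_list w Minus) Minus @ replicate (count_list w Plus) Plus)"
proof -
  let ?E = "equinumerous_words d L"
  have refl: "?E u u" for u by (simp add: equinumerous_words_def)
  have trans [trans]: "?E u w" if "?E u v" "?E v w" for u v w
    using that by (simp add: equinumerous_words_def)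
  note append = equinumerous_words_append[OF \<open>1 \<le> d\<close>]
  have move: "?E (Plus # replicate n Minus) (replicate n Minus @ [Plus])" for n
  proof (induction n)
    case 0
    then show ?case by (simp add: refl)
  next
    case (Suc n)
    have "?E (Plus # replicate (Suc n) Minus) (Minus # Plus # replicate n Minus)"
      using append[OF Plus_Minus_commute[OF assms] refl, of "replicate n Minus"] by simp
    also have "?E (Minus # Plus # replicate n Minus) (replicate (Suc n) Minus @ [Plus])"
      using append[OF refl Suc, of "[Minus]"] by simp
    finally show ?case .
  qed
  show ?thesis
  proof (induction w)
    case Nil
    then show ?case by (simp add: refl)
  next
    case (Cons s w)
    let ?n = "count_list w Minus" and ?m = "count_list w Plus"
    have sorted: "?E (s # w) ([s] @ (replicate ?n Minus @ replicate ?m Plus))"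
      using append[OF refl Cons, of "[s]"] by simp
    show ?case
    proof (cases s)
      case Minus
      then show ?thesis using sorted by simp
    next
      case Plus
      have "?E ((Plus # replicate ?n Minus) @ replicate ?m Plus)
         ((replicate ?n Minus @ [Plus]) @ replicate ?m Plus)"
        by (rule append[OF move refl])
      then show ?thesis using sorted trans Plus by simp
    qed
  qed
qed

lemma OCT_rev_Minus:
  "card (OCT d L (replicate n Minus) al be) = card (OCT d L (replicate n Plus) be al)"
proof -
  have mid: "sign_step d s (rev rs ! k) (rev rs ! Suc k)"
    if "\<forall>k < n. sign_step d t (rs ! k) (rs ! Suc k)" "k < n" "length rs = Suc n"
      and flip: "\<And>lam mu. sign_step d t lam mu \<Longrightarrow> sign_step d s mu lam" for rs k s t
  proof -
    have "rev rs ! k = rs ! Suc (n - Suc k)" "rev rs ! Suc k = rs ! (n - Suc k)"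
      using that(2,3) by (auto simp: rev_nth Suc_diff_Suc)
    moreover have "n - Suc k < n" using that(2) by simp
    ultimately show ?thesis using that(1) flip by simp
  qed
  have "rev ` OCT d L (replicate n Minus) al be \<subseteq> OCT d L (replicate n Plus) be al"
    using mid[where s = Plus and t = Minus]
    by (auto simp: OCT_iff sign_step_Minus_iff rev_nth simp del: sign_step.simps(2))
  moreover have "rev ` OCT d L (replicate n Plus) be al \<subseteq> OCT d L (replicate n Minus) al be"
    using mid[where s = Minus and t = Plus]
    by (auto simp: OCT_iff sign_step_Minus_iff rev_nth simp del: sign_step.simps(2))
  ultimately have "bij_betw rev (OCT d L (replicate n Minus) al be) (OCT d L (replicate n Plus) be al)"
    by (intro bij_betw_byWitness[where f' = rev]) auto
  then show ?thesis by (rule bij_betw_same_card)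
qed

section \<open>Growth diagrams and the corner word\<close>

text \<open>The labels met when walking down the left column from \<open>(0, n)\<close> to \<open>(0, 0)\<close> and then along the
  bottom row to \<open>(m, 0)\<close>.\<close>

definition corner_path :: "nat \<Rightarrow> nat \<Rightarrow> (nat \<times> nat \<Rightarrow> int \<Rightarrow> int) \<Rightarrow> (int \<Rightarrow> int) list" where
  "corner_path m n G = map (\<lambda>k. if k \<le> n then G (0, n - k) else G (k - n, 0)) [0..<m + n + 1]"

lemma corner_path_nth:
  assumes "k \<le> m + n"
  shows "corner_path m n G ! k = (if k \<le> n then G (0, n - k) else G (k - n, 0))"
  using nth_map_upt[of k "m + n + 1" 0 "\<lambda>k. if k \<le> n then G (0, n - k) else G (k - n, 0)"] assms
  unfolding corner_path_def by simp

lemma growth_diagrams_iff: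
  "G \<in> growth_diagrams d L m n \<longleftrightarrow>
     G \<in> extensional ({0..m} \<times> {0..n}) \<and>
     (\<forall>x y. x \<le> m \<and> y \<le> n \<longrightarrow> G (x, y) \<in> shapes d L) \<and>
     (\<forall>x y. x < m \<and> y \<le> n \<longrightarrow> (\<exists>i. G (Suc x, y) = add_cell d i (G (x, y)))) \<and>
     (\<forall>x y. x \<le> m \<and> y < n \<longrightarrow> (\<exists>i. G (x, Suc y) = add_cell d i (G (x, y)))) \<and>
     (\<forall>x y. x < m \<and> y < n \<longrightarrow>
          forward_rule d (G (x, y)) (G (x, Suc y)) (G (Suc x, y)) (G (Suc x, Suc y)))"
  unfolding growth_diagrams_def PiE_def Pi_def by auto

lemma corner_word_nth:
  "k < n \<Longrightarrow> (replicate n Minus @ replicate m Plus) ! k = Minus"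
  "n \<le> k \<Longrightarrow> k < m + n \<Longrightarrow> (replicate n Minus @ replicate m Plus) ! k = Plus"
  by (auto simp: nth_append)

lemma corner_path_in_OCT:
  assumes G: "G \<in> growth_diagrams d L m n"
  shows "corner_path m n G \<in> OCT d L (replicate n Minus @ replicate m Plus) (G (0, n)) (G (m, 0))"
proof -
  have sh: "corner_path m n G ! k \<in> shapes d L" if "k \<le> n + m" for k
    using G that by (auto simp: corner_path_nth growth_diagrams_iff)
  have st: "sign_step d ((replicate n Minus @ replicate m Plus) ! k)
      (corner_path m n G ! k) (corner_path m n G ! Suc k)" if "k < n + m" for k
  proof (cases "k < n")
    case True
    then have "\<exists>i. G (0, Suc (n - Suc k)) = add_cell d i (G (0, n - Suc k))"
      using G unfolding growth_diagrams_iff by simp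
    then show ?thesis using True
      by (simp add: corner_path_nth corner_word_nth sign_step_Minus_iff Suc_diff_Suc del: sign_step.simps(2))
  next
    case False
    then have "\<exists>i. G (Suc (k - n), 0) = add_cell d i (G (k - n, 0))"
      using G that unfolding growth_diagrams_iff by (metis add.commute le0 less_diff_conv2 not_less)
    then show ?thesis using False that
      by (cases "k = n") (auto simp: corner_path_nth corner_word_nth Suc_diff_le)
  qed
  have "corner_path m n G ! 0 = G (0, n)" "corner_path m n G ! (n + m) = G (m, 0)"
    by (cases "m = 0"; simp add: corner_path_nth)+
  then show ?thesis using sh st by (simp add: OCT_iff corner_path_def[THEN arg_cong[where f = length]])
qed

lemma forward_rule_unique:
  assumes "UL = add_cell d i LL" "forward_rule d LL UL LR UR" "forward_rule d LL UL LR UR'"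
  shows "UR = UR'"
proof (cases "UL = LR")
  case True
  then show ?thesis using assms unfolding forward_rule_def by blast
next
  case False
  then have "UR r = UR' r" for r using assms(2,3) unfolding forward_rule_def by simp
  then show ?thesis by blast
qed

lemma growth_diagram_determined:
  assumes G: "G \<in> growth_diagrams d L m n" and H: "H \<in> growth_diagrams d L m n"
    and left: "\<And>y. y \<le> n \<Longrightarrow> G (0, y) = H (0, y)" and bottom: "\<And>x. x \<le> m \<Longrightarrow> G (x, 0) = H (x, 0)"
  shows "G = H"
proof -
  have agree: "x \<le> m \<Longrightarrow> y \<le> n \<Longrightarrow> G (x, y) = H (x, y)" for x y
  proof (induction x arbitrary: y)
    case 0
    then show ?case using left by simp
  next
    case (Suc x)
    note col = Suc.IH
    from Suc.prems(2) show ?case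
    proof (induction y)
      case 0
      then show ?case using bottom \<open>Suc x \<le> m\<close> by simp
    next
      case (Suc y)
      have xy: "x < m" "y < n" using Suc.prems \<open>Suc x \<le> m\<close> by auto
      have eq: "G (x, y) = H (x, y)" "G (x, Suc y) = H (x, Suc y)" "G (Suc x, y) = H (Suc x, y)"
        using col[of y] col[of "Suc y"] Suc xy by auto
      have "forward_rule d (G (x, y)) (G (x, Suc y)) (G (Suc x, y)) (G (Suc x, Suc y))"
        "forward_rule d (H (x, y)) (H (x, Suc y)) (H (Suc x, y)) (H (Suc x, Suc y))"
        using G H xy unfolding growth_diagrams_iff by blast+
      moreover obtain i where "G (x, Suc y) = add_cell d i (G (x, y))"
        using G xy unfolding growth_diagrams_iff by (metis less_imp_le)
      ultimately show ?case using forward_rule_unique eq by metis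
    qed
  qed
  show ?thesis
  proof
    fix p :: "nat \<times> nat"
    obtain x y where p: "p = (x, y)" by (cases p)
    show "G p = H p"
      using agree[of x y] G H p unfolding growth_diagrams_iff extensional_def by (cases "x \<le> m \<and> y \<le> n") auto
  qed
qed

text \<open>Filling the grid square by square from its left column and bottom row. The choice is made among
  the shapes that lie above both neighbours and satisfy the local rule; there is exactly one by
  \<open>forward_ex1_above\<close>, provided that the labels already present are correct.\<close>

fun grow :: "int \<Rightarrow> int \<Rightarrow> (nat \<Rightarrow> int \<Rightarrow> int) \<Rightarrow> (nat \<Rightarrow> int \<Rightarrow> int) \<Rightarrow> nat \<Rightarrow> nat \<Rightarrow> int \<Rightarrow> int" where
  "grow d L left bottom 0 y = left y"
| "grow d L left bottom (Suc x) 0 = bottom (Suc x)"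
| "grow d L left bottom (Suc x) (Suc y) =
    (let LL = grow d L left bottom x y; UL = grow d L left bottom x (Suc y);
         LR = grow d L left bottom (Suc x) y
     in SOME UR. UR \<in> above d L UL LR \<and> forward_rule d LL UL LR UR)"

lemma growth_diagram_exists:
  assumes "1 \<le> d" "1 \<le> L"
    and left: "\<And>y. y \<le> n \<Longrightarrow> left y \<in> shapes d L" "\<And>y. y < n \<Longrightarrow> \<exists>i. left (Suc y) = add_cell d i (left y)"
    and bottom: "\<And>x. x \<le> m \<Longrightarrow> bottom x \<in> shapes d L"
      "\<And>x. x < m \<Longrightarrow> \<exists>i. bottom (Suc x) = add_cell d i (bottom x)"
    and corner: "left 0 = bottom 0"
  obtains G where "G \<in> growth_diagrams d L m n" "\<And>y. y \<le> n \<Longrightarrow> G (0, y) = left y"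
    "\<And>x. x \<le> m \<Longrightarrow> G (x, 0) = bottom x"
proof -
  let ?g = "grow d L left bottom"
  have g0: "?g x 0 = bottom x" for x using corner by (cases x) auto
  have square: "?g (Suc x) (Suc y) \<in> above d L (?g x (Suc y)) (?g (Suc x) y)"
      "forward_rule d (?g x y) (?g x (Suc y)) (?g (Suc x) y) (?g (Suc x) (Suc y))"
    if "?g x (Suc y) \<in> shapes d L" "?g (Suc x) y \<in> shapes d L"
       "?g x y \<in> below d L (?g x (Suc y)) (?g (Suc x) y)" for x y
    using someI_ex[OF ex1_implies_ex[OF forward_ex1_above[OF assms(1,2) that]]]
    unfolding grow.simps Let_def by blast+
  \<comment> \<open>The choice in the definition is meaningful only for squares whose other corners are valid, so
    validity of the labels and of the edges pointing to them is proved by induction along the grid.\<close>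
  have ok: "?g x y \<in> shapes d L \<and> (0 < x \<longrightarrow> (\<exists>i. ?g x y = add_cell d i (?g (x - 1) y))) \<and>
      (0 < y \<longrightarrow> (\<exists>i. ?g x y = add_cell d i (?g x (y - 1))))" if "x \<le> m" "y \<le> n" for x y
    using that
  proof (induction x arbitrary: y)
    case 0
    then show ?case using left(1)[of y] left(2)[of "y - 1"] by (cases y) auto
  next
    case (Suc x)
    note col = Suc.IH
    from Suc.prems have "x \<le> m" by simp
    from Suc.prems(2) show ?case
    proof (induction y)
      case 0
      then show ?case
        using bottom(1)[of "Suc x"] bottom(2)[of x] \<open>Suc x \<le> m\<close> unfolding g0 by simp
    next
      case (Suc y)
      have a: "?g x (Suc y) \<in> shapes d L" "?g x y \<in> shapes d L" "?g (Suc x) y \<in> shapes d L"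
        using col[OF \<open>x \<le> m\<close>, of "Suc y"] col[OF \<open>x \<le> m\<close>, of y] Suc by (simp_all only: Suc_leD)
      have "\<exists>i. ?g x (Suc y) = add_cell d i (?g x y)"
        using col[OF \<open>x \<le> m\<close> Suc.prems] unfolding diff_Suc_1 by blast
      moreover have "\<exists>i. ?g (Suc x) y = add_cell d i (?g x y)"
        using Suc.IH[OF Suc_leD[OF Suc.prems]] unfolding diff_Suc_1 by blast
      ultimately have "?g x y \<in> below d L (?g x (Suc y)) (?g (Suc x) y)"
        using a(2) unfolding below_def by blast
      from square(1)[OF a(1,3) this]
      show ?case unfolding above_def diff_Suc_1 by blast
    qed
  qed
  define G where "G = restrict (\<lambda>(x, y). ?g x y) ({0..m} \<times> {0..n})"
  have G: "G (x, y) = ?g x y" if "x \<le> m" "y \<le> n" for x y using that by (simp add: G_def)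
  have "G \<in> growth_diagrams d L m n"
    unfolding growth_diagrams_iff
  proof (intro conjI allI impI)
    show "G \<in> extensional ({0..m} \<times> {0..n})" by (simp add: G_def)
  next
    fix x y assume "x \<le> m \<and> y \<le> n"
    then show "G (x, y) \<in> shapes d L" using ok G by simp
  next
    fix x y assume "x < m \<and> y \<le> n"
    then show "\<exists>i. G (Suc x, y) = add_cell d i (G (x, y))"
      using ok[of "Suc x" y] by (simp add: G del: grow.simps)
  next
    fix x y assume "x \<le> m \<and> y < n"
    then show "\<exists>i. G (x, Suc y) = add_cell d i (G (x, y))"
      using ok[of x "Suc y"] by (simp add: G del: grow.simps)
  next
    fix x y assume xy: "x < m \<and> y < n"
    have s: "?g x (Suc y) \<in> shapes d L" "?g (Suc x) y \<in> shapes d L" "?g x y \<in> shapes d L"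
      using ok xy by (auto simp del: grow.simps)
    have "\<exists>i. ?g x (Suc y) = add_cell d i (?g x y)" "\<exists>i. ?g (Suc x) y = add_cell d i (?g x y)"
      using ok[of x "Suc y"] ok[of "Suc x" y] xy by (simp_all del: grow.simps)
    then have "?g x y \<in> below d L (?g x (Suc y)) (?g (Suc x) y)"
      using s(3) unfolding below_def by blast
    from square(2)[OF s(1,2) this]
    show "forward_rule d (G (x, y)) (G (x, Suc y)) (G (Suc x, y)) (G (Suc x, Suc y))"
      using xy by (simp add: G del: grow.simps)
  qed
  then show thesis using that G g0 by simp
qed

text \<open>Restriction to the left column and bottom row is injective because the local rule determines the
  upper right label of a square, and surjective because it can always be satisfied.\<close>

lemma bij_betw_corner_path:
  assumes "1 \<le> d" "1 \<le> L"
  shows "bij_betw (corner_path m n) {G \<in> growth_diagrams d L m n. G (0, n) = al \<and> G (m, 0) = be}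
     (OCT d L (replicate n Minus @ replicate m Plus) al be)"
  unfolding bij_betw_def
proof (intro conjI inj_onI equalityI subsetI)
  have cp: "corner_path m n G ! (n - y) = G (0, y)" if "y \<le> n" for G y
    using that by (simp add: corner_path_nth)
  have cp': "corner_path m n G ! (n + x) = G (x, 0)" if "x \<le> m" for G x
    using that by (simp add: corner_path_nth)
  show "G = H" if "G \<in> {G \<in> growth_diagrams d L m n. G (0, n) = al \<and> G (m, 0) = be}"
    "H \<in> {G \<in> growth_diagrams d L m n. G (0, n) = al \<and> G (m, 0) = be}"
    "corner_path m n G = corner_path m n H" for G H
    using that cp[of _ G] cp[of _ H] cp'[of _ G] cp'[of _ H]
    by (intro growth_diagram_determined[of G d L m n H]) auto
  show "rs \<in> OCT d L (replicate n Minus @ replicate m Plus) al be"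
    if "rs \<in> corner_path m n ` {G \<in> growth_diagrams d L m n. G (0, n) = al \<and> G (m, 0) = be}" for rs
    using that corner_path_in_OCT by auto
  show "rs \<in> corner_path m n ` {G \<in> growth_diagrams d L m n. G (0, n) = al \<and> G (m, 0) = be}"
    if rs: "rs \<in> OCT d L (replicate n Minus @ replicate m Plus) al be" for rs
  proof -
    have len: "length rs = m + n + 1" and sh: "\<And>k. k \<le> m + n \<Longrightarrow> rs ! k \<in> shapes d L"
      and ends: "rs ! 0 = al" "rs ! (m + n) = be"
      and st: "\<And>k. k < m + n \<Longrightarrow> sign_step d ((replicate n Minus @ replicate m Plus) ! k) (rs ! k) (rs ! Suc k)"
      using rs by (auto simp: OCT_iff add.commute)
    have down: "\<exists>i. rs ! (n - Suc y) = add_cell d i (rs ! (n - y))" if "y < n" for y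
      using st[of "n - Suc y"] that
      by (simp add: corner_word_nth sign_step_Minus_iff Suc_diff_Suc del: sign_step.simps(2))
    have right: "\<exists>i. rs ! (n + Suc x) = add_cell d i (rs ! (n + x))" if "x < m" for x
      using st[of "n + x"] that by (simp add: corner_word_nth)
    obtain G where G: "G \<in> growth_diagrams d L m n" "\<And>y. y \<le> n \<Longrightarrow> G (0, y) = rs ! (n - y)"
      "\<And>x. x \<le> m \<Longrightarrow> G (x, 0) = rs ! (n + x)"
      by (rule growth_diagram_exists[OF assms, of n "\<lambda>y. rs ! (n - y)" m "\<lambda>x. rs ! (n + x)"])
         (use down right sh in auto)
    have "rs = corner_path m n G"
      by (rule nth_equalityI) (auto simp: len corner_path_nth G corner_path_def[THEN arg_cong[where f = length]])
    moreover have "G (0, n) = al" "G (m, 0) = be" using G ends by (auto simp: add.commute)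
    ultimately show ?thesis using G(1) by blast
  qed
qed

section \<open>Standard cylindric tableaux as increasing walks\<close>

lemma diagram_add_cell:
  assumes "nu \<in> shapes d L" "add_cell d i nu \<in> shapes d L"
  shows "diagram d L (add_cell d i nu) = insert (cell d L i (nu i + 1)) (diagram d L nu)"
proof (intro set_eqI)
  fix c
  show "c \<in> diagram d L (add_cell d i nu) \<longleftrightarrow> c \<in> insert (cell d L i (nu i + 1)) (diagram d L nu)"
  proof
    assume "c \<in> diagram d L (add_cell d i nu)"
    then obtain r j where c: "c = cell d L r j" "j \<le> add_cell d i nu r"
      unfolding diagram_def by blast
    show "c \<in> insert (cell d L i (nu i + 1)) (diagram d L nu)"
    proof (cases "j \<le> nu r")
      case True
      then show ?thesis using c cell_in_diagram_iff[OF assms(1)] by simp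
    next
      case False
      then have "d dvd r - i" "j = nu r + 1" using c(2) by (auto simp: add_cell_def split: if_splits)
      then obtain k where r: "r = i - (- k) * d" by (auto simp: dvd_def algebra_simps)
      have "j = nu i + 1 + (- k) * L"
        using \<open>j = nu r + 1\<close> shapes_period[OF assms(1), of i "- k"] r by simp
      then have "c = cell d L (i - (- k) * d) (nu i + 1 + (- k) * L)" using c(1) r by simp
      then show ?thesis by (simp only: cell_shift insertI1)
    qed
  next
    assume "c \<in> insert (cell d L i (nu i + 1)) (diagram d L nu)"
    moreover have "cell d L i (nu i + 1) \<in> diagram d L (add_cell d i nu)"
      by (subst cell_in_diagram_iff[OF assms(2)]) (simp add: add_cell_def)
    moreover have "c \<in> diagram d L (add_cell d i nu)" if "c \<in> diagram d L nu"
    proof -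
      obtain r j where "c = cell d L r j" "j \<le> nu r"
        using \<open>c \<in> diagram d L nu\<close> unfolding diagram_def by blast
      then show ?thesis using cell_in_diagram_iff[OF assms(2)] by (simp add: add_cell_def)
    qed
    ultimately show "c \<in> diagram d L (add_cell d i nu)" by blast
  qed
qed

lemma diagram_mono: "mu \<le> lam \<Longrightarrow> diagram d L mu \<subseteq> diagram d L lam"
  unfolding diagram_def le_fun_def by (blast intro: order_trans)

lemma diagram_inject:
  assumes "lam \<in> shapes d L" "mu \<in> shapes d L" "diagram d L lam = diagram d L mu"
  shows "lam = mu"
proof
  fix i
  have "j \<le> lam i \<longleftrightarrow> j \<le> mu i" for j
    using cell_in_diagram_iff assms by metis
  then show "lam i = mu i" by (meson order_antisym order_refl)
qed

lemma le_add_cell: "nu \<le> add_cell d i nu"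
  by (simp add: le_fun_def add_cell_def)

lemma skew_diagram_add_cell:
  assumes "nu \<in> shapes d L" "add_cell d i nu \<in> shapes d L" "mu \<le> nu"
  shows "skew_diagram d L (add_cell d i nu) mu = insert (cell d L i (nu i + 1)) (skew_diagram d L nu mu)"
    and "cell d L i (nu i + 1) \<notin> skew_diagram d L nu mu"
    and "diagram d L (add_cell d i nu) - diagram d L nu = {cell d L i (nu i + 1)}"
proof -
  have n: "cell d L i (nu i + 1) \<notin> diagram d L nu" by (simp add: cell_in_diagram_iff[OF assms(1)])
  have "diagram d L mu \<subseteq> diagram d L nu" by (rule diagram_mono[OF assms(3)])
  then show "skew_diagram d L (add_cell d i nu) mu = insert (cell d L i (nu i + 1)) (skew_diagram d L nu mu)"
    "cell d L i (nu i + 1) \<notin> skew_diagram d L nu mu"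
    "diagram d L (add_cell d i nu) - diagram d L nu = {cell d L i (nu i + 1)}"
    using n unfolding skew_diagram_def diagram_add_cell[OF assms(1,2)] by blast+
qed

lemma sum_period_indicator:
  fixes d :: int
  assumes "1 \<le> d"
  shows "(\<Sum>r = 1..d. if d dvd r - i then 1 else 0 :: int) = 1"
proof -
  obtain k where k: "i - k * d \<in> {1..d}" using representative_row[OF assms] by blast
  have "d dvd r - i \<longleftrightarrow> r = i - k * d" if "r \<in> {1..d}" for r
  proof
    assume "d dvd r - i"
    then have "d dvd (r - i) + k * d" by simp
    moreover have "(r - i) + k * d = r - (i - k * d)" by simp
    ultimately have dvd: "d dvd r - (i - k * d)" by simp
    have "\<bar>r - (i - k * d)\<bar> < d" using that k by auto
    then show "r = i - k * d" using dvd_imp_le_int[OF _ dvd] by force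
  qed simp
  then have "(\<Sum>r = 1..d. if d dvd r - i then 1 else 0 :: int) = (\<Sum>r = 1..d. if r = i - k * d then 1 else 0)"
    by (intro sum.cong) auto
  then show ?thesis using k by simp
qed

lemma skew_size_add_cell:
  assumes "1 \<le> d"
  shows "skew_size d (add_cell d i nu) mu = skew_size d nu mu + 1"
proof -
  have "skew_size d (add_cell d i nu) mu = (\<Sum>r = 1..d. (nu r - mu r) + (if d dvd r - i then 1 else 0))"
    unfolding skew_size_def by (intro sum.cong) (auto simp: add_cell_def)
  then show ?thesis by (simp add: sum.distrib sum_period_indicator[OF assms] skew_size_def)
qed

text \<open>Deleting the largest entry. In the other direction the new cell may carry the largest entry
  because no cell of the larger diagram lies to its right or below it (\<open>no_right\<close>, \<open>no_below\<close>).\<close>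

lemma bij_betw_restrict_SCT:
  assumes "1 \<le> d" "1 \<le> L" and mu: "mu \<in> shapes d L" and nu: "nu \<in> shapes d L"
    and lam: "add_cell d i nu \<in> shapes d L" and le: "mu \<le> nu" and size: "skew_size d nu mu = int N"
  shows "bij_betw (\<lambda>T. restrict T (skew_diagram d L nu mu))
    {T \<in> SCT d L (add_cell d i nu) mu. T (cell d L i (nu i + 1)) = Suc N} (SCT d L nu mu)"
proof -
  let ?lam = "add_cell d i nu" and ?c = "cell d L i (nu i + 1)"
  let ?D = "skew_diagram d L nu mu"
  note D = skew_diagram_add_cell[OF nu lam le]
  have sizes: "nat (skew_size d ?lam mu) = Suc N" "nat (skew_size d nu mu) = N"
    using skew_size_add_cell[OF \<open>1 \<le> d\<close>, of i nu mu] size by simp_all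
  have ivl: "{1..Suc N} = insert (Suc N) {1..N}" by auto
  have lam_iff: "T \<in> SCT d L ?lam mu \<longleftrightarrow> T \<in> extensional (insert ?c ?D) \<and>
      bij_betw T (insert ?c ?D) (insert (Suc N) {1..N}) \<and>
      (\<forall>i j. cell d L i j \<in> insert ?c ?D \<and> cell d L i (j + 1) \<in> insert ?c ?D
          \<longrightarrow> T (cell d L i j) < T (cell d L i (j + 1))) \<and>
      (\<forall>i j. cell d L i j \<in> insert ?c ?D \<and> cell d L (i + 1) j \<in> insert ?c ?D
          \<longrightarrow> T (cell d L i j) < T (cell d L (i + 1) j))" for T
    by (simp only: SCT_def D(1) sizes ivl mem_Collect_eq)
  have nu_iff: "T \<in> SCT d L nu mu \<longleftrightarrow> T \<in> extensional ?D \<and> bij_betw T ?D {1..N} \<and>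
      (\<forall>i j. cell d L i j \<in> ?D \<and> cell d L i (j + 1) \<in> ?D
          \<longrightarrow> T (cell d L i j) < T (cell d L i (j + 1))) \<and>
      (\<forall>i j. cell d L i j \<in> ?D \<and> cell d L (i + 1) j \<in> ?D
          \<longrightarrow> T (cell d L i j) < T (cell d L (i + 1) j))" for T
    by (simp only: SCT_def sizes mem_Collect_eq)
  have c_diag: "?c \<in> diagram d L ?lam" "?c \<notin> diagram d L nu"
    using cell_in_diagram_iff[OF lam] cell_in_diagram_iff[OF nu] by (auto simp: add_cell_def)
  have in_lam: "b \<in> diagram d L ?lam" if "b \<in> insert ?c ?D" for b
    using that unfolding D(1)[symmetric] by (simp add: skew_diagram_def)
  have no_right: "cell d L r (j + 1) \<notin> insert ?c ?D" if "cell d L r j = ?c" for r j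
  proof
    assume "cell d L r (j + 1) \<in> insert ?c ?D"
    then have "cell d L r (j + 1) \<in> diagram d L ?lam" by (rule in_lam)
    then have j: "j + 1 \<le> ?lam r" using cell_in_diagram_iff[OF lam] by simp
    have "\<not> j \<le> nu r" using that c_diag(2) cell_in_diagram_iff[OF nu] by metis
    then show False using j by (simp add: add_cell_def split: if_splits)
  qed
  have no_below: "cell d L (r + 1) j \<notin> insert ?c ?D" if c: "cell d L r j = ?c" for r j
  proof
    assume a: "cell d L (r + 1) j \<in> insert ?c ?D"
    have j: "\<not> j \<le> nu r" using c c_diag(2) cell_in_diagram_iff[OF nu] by metis
    show False
    proof (cases "cell d L (r + 1) j = ?c")
      case True
      \<comment> \<open>On a cylinder of circumference one a cell could be below itself, but only if \<open>L\<close> were zero.\<close>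
      then obtain k where "r + 1 = r - k * d" "j = j + k * L" using c cell_eqD by metis
      then show False using \<open>1 \<le> L\<close> by simp
    next
      case False
      then have "cell d L (r + 1) j \<in> diagram d L nu" using a by (simp add: skew_diagram_def)
      then have "j \<le> nu (r + 1)" using cell_in_diagram_iff[OF nu] by simp
      then show False using j shapes_step[OF nu, of r] by simp
    qed
  qed
  show ?thesis
  proof (rule bij_betw_byWitness[where f' = "\<lambda>T. T(?c := Suc N)"])
    show "\<forall>T\<in>{T \<in> SCT d L ?lam mu. T ?c = Suc N}. (restrict T ?D)(?c := Suc N) = T"
      by (auto simp: lam_iff extensional_def fun_eq_iff restrict_def)
    show "\<forall>T\<in>SCT d L nu mu. restrict (T(?c := Suc N)) ?D = T"
      using D(2) by (auto simp: nu_iff extensional_def fun_eq_iff restrict_def)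
    show "(\<lambda>T. restrict T ?D) ` {T \<in> SCT d L ?lam mu. T ?c = Suc N} \<subseteq> SCT d L nu mu"
    proof (rule image_subsetI)
      fix T assume T: "T \<in> {T \<in> SCT d L ?lam mu. T ?c = Suc N}"
      then have "bij_betw T (insert ?c ?D) (insert (T ?c) {1..N})" by (simp only: mem_Collect_eq lam_iff)
      moreover have "T ?c \<notin> {1..N}" using T by simp
      ultimately have "bij_betw T ?D {1..N}"
        using D(2) notIn_Un_bij_betw3[of ?c ?D T "{1..N}"] by simp
      then have "bij_betw (restrict T ?D) ?D {1..N}"
        by (subst bij_betw_cong[where g = T]) auto
      then show "restrict T ?D \<in> SCT d L nu mu"
        using T by (simp add: lam_iff nu_iff)
    qed
    show "(\<lambda>T. T(?c := Suc N)) ` SCT d L nu mu \<subseteq> {T \<in> SCT d L ?lam mu. T ?c = Suc N}"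
    proof (rule image_subsetI)
      fix T assume T: "T \<in> SCT d L nu mu"
      let ?T = "T(?c := Suc N)"
      have bij: "bij_betw T ?D {1..N}" using T by (simp only: nu_iff)
      have "bij_betw ?T ?D {1..N}" using bij D(2) by (subst bij_betw_cong[where g = T]) auto
      then have bij': "bij_betw ?T (insert ?c ?D) (insert (Suc N) {1..N})"
        using D(2) notIn_Un_bij_betw3[of ?c ?D ?T "{1..N}"] by simp
      have small: "T b < Suc N" if "b \<in> ?D" for b using bij_betwE[OF bij] that by fastforce
      have row: "?T (cell d L r j) < ?T (cell d L r (j + 1))"
        if "cell d L r j \<in> insert ?c ?D" "cell d L r (j + 1) \<in> insert ?c ?D" for r j
        using that no_right[of r j] small[of "cell d L r j"] T by (auto simp: nu_iff)
      have col: "?T (cell d L r j) < ?T (cell d L (r + 1) j)"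
        if "cell d L r j \<in> insert ?c ?D" "cell d L (r + 1) j \<in> insert ?c ?D" for r j
        using that no_below[of r j] small[of "cell d L r j"] T by (auto simp: nu_iff)
      have "?T \<in> extensional (insert ?c ?D)" using T by (auto simp: nu_iff extensional_def)
      then have "?T \<in> SCT d L ?lam mu" using bij' row col unfolding lam_iff by blast
      then show "?T \<in> {T \<in> SCT d L ?lam mu. T ?c = Suc N}" by simp
    qed
  qed
qed

text \<open>The cell with the largest entry is the last one in its row, and the next row is strictly shorter,
  since otherwise the neighbour to the right or below would have a larger entry. Hence it is a corner
  that can be removed.\<close>

lemma SCT_max_cell:
  assumes "1 \<le> d" "1 \<le> L" and mu: "mu \<in> shapes d L" and lam: "lam \<in> shapes d L"
    and le: "mu \<le> lam" and size: "skew_size d lam mu = int (Suc N)" and T: "T \<in> SCT d L lam mu"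
  obtains nu i where "nu \<in> shapes d L" "mu \<le> nu" "lam = add_cell d i nu" "T (cell d L i (nu i + 1)) = Suc N"
proof -
  let ?D = "skew_diagram d L lam mu"
  have bij: "bij_betw T ?D {1..Suc N}" using T unfolding SCT_def size nat_int by blast
  have "Suc N \<in> T ` ?D" using bij unfolding bij_betw_def by simp
  then obtain c where c: "c \<in> ?D" "T c = Suc N" by (metis imageE)
  have top: "T b \<le> Suc N" if "b \<in> ?D" for b using bij_betwE[OF bij] that by fastforce
  obtain i j where ij: "c = cell d L i j" "j \<le> lam i" "mu i < j"
    using c(1) cell_in_diagram_iff[OF mu] unfolding skew_diagram_def diagram_def by fastforce
  have inD: "cell d L r s \<in> ?D \<longleftrightarrow> s \<le> lam r \<and> mu r < s" for r s
    using cell_in_diagram_iff[OF mu] cell_in_diagram_iff[OF lam] unfolding skew_diagram_def by auto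
  have "\<not> j + 1 \<le> lam i"
  proof
    assume "j + 1 \<le> lam i"
    then have b: "cell d L i (j + 1) \<in> ?D" using ij inD by simp
    then have "T (cell d L i j) < T (cell d L i (j + 1))" using T c(1) ij(1) unfolding SCT_def by blast
    then show False using top[OF b] c(2) ij(1) by simp
  qed
  then have j: "j = lam i" using ij(2) by simp
  have "lam (i + 1) < lam i"
  proof (rule ccontr)
    assume "\<not> lam (i + 1) < lam i"
    then have b: "cell d L (i + 1) j \<in> ?D" using ij j inD shapes_step[OF mu, of i] by simp
    then have "T (cell d L i j) < T (cell d L (i + 1) j)" using T c(1) ij(1) unfolding SCT_def by blast
    then show False using top[OF b] c(2) ij(1) by simp
  qed
  then have nu: "remove_cell d i lam \<in> shapes d L"
    using remove_cell_in_shapes_iff[OF assms(1,2) lam] by simp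
  have "mu r \<le> remove_cell d i lam r" for r
  proof (cases "d dvd r - i")
    case True
    then obtain k where "r = i - (- k) * d" by (auto simp: dvd_def algebra_simps)
    then have "mu r < lam r"
      using shapes_period[OF mu, of i "- k"] shapes_period[OF lam, of i "- k"] ij by simp
    then show ?thesis by (simp add: remove_cell_def)
  qed (use le in \<open>simp add: remove_cell_def le_fun_def\<close>)
  then have "mu \<le> remove_cell d i lam" by (simp add: le_fun_def)
  moreover have "T (cell d L i (remove_cell d i lam i + 1)) = Suc N"
    using c(2) ij(1) j by (simp add: remove_cell_def)
  ultimately show thesis using nu by (intro that[of "remove_cell d i lam" i]) simp_all
qed

text \<open>Tableaux are classified by the shape that remains when the cell with the largest entry is
  deleted.\<close>

lemma card_SCT_Suc:
  assumes "1 \<le> d" "1 \<le> L" and mu: "mu \<in> shapes d L" and lam: "lam \<in> shapes d L"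
    and le: "mu \<le> lam" and size: "skew_size d lam mu = int (Suc N)"
  defines "P \<equiv> {nu \<in> shapes d L. mu \<le> nu \<and> (\<exists>i. lam = add_cell d i nu)}"
  shows "finite P" and "card (SCT d L lam mu) = (\<Sum>nu\<in>P. card (SCT d L nu mu))"
proof -
  have "P \<subseteq> {nu \<in> shapes d L. \<forall>r\<in>{1..d}. mu r \<le> nu r \<and> nu r \<le> lam r}"
    unfolding P_def by (auto simp: le_fun_def le_add_cell[unfolded le_fun_def])
  then show fin: "finite P" using finite_shapes_between[OF \<open>1 \<le> d\<close>] by (rule finite_subset)
  let ?F = "\<lambda>nu. {T \<in> SCT d L lam mu. \<forall>c \<in> diagram d L lam - diagram d L nu. T c = Suc N}"
  have fiber: "card (?F nu) = card (SCT d L nu mu)" if "nu \<in> P" for nu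
  proof -
    obtain i where nu: "nu \<in> shapes d L" "mu \<le> nu" "lam = add_cell d i nu"
      using \<open>nu \<in> P\<close> unfolding P_def by blast
    have "skew_size d nu mu = int N" using skew_size_add_cell[OF \<open>1 \<le> d\<close>, of i nu mu] size nu by simp
    then have "bij_betw (\<lambda>T. restrict T (skew_diagram d L nu mu))
        {T \<in> SCT d L (add_cell d i nu) mu. T (cell d L i (nu i + 1)) = Suc N} (SCT d L nu mu)"
      using nu lam by (intro bij_betw_restrict_SCT assms(1,2) mu) auto
    then have "card {T \<in> SCT d L lam mu. T (cell d L i (nu i + 1)) = Suc N} = card (SCT d L nu mu)"
      unfolding nu(3) by (rule bij_betw_same_card)
    moreover have "diagram d L lam - diagram d L nu = {cell d L i (nu i + 1)}"
      using skew_diagram_add_cell(3)[OF nu(1) _ nu(2), of i] lam unfolding nu(3) by blast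
    ultimately show ?thesis by simp
  qed
  have "SCT d L lam mu = (\<Union>nu\<in>P. ?F nu)"
  proof (intro equalityI subsetI)
    fix T assume T: "T \<in> SCT d L lam mu"
    obtain nu i where nu: "nu \<in> shapes d L" "mu \<le> nu" "lam = add_cell d i nu" "T (cell d L i (nu i + 1)) = Suc N"
      using SCT_max_cell[OF assms(1-6) T] .
    then have "diagram d L lam - diagram d L nu = {cell d L i (nu i + 1)}"
      using skew_diagram_add_cell(3)[OF nu(1) _ nu(2), of i] lam by blast
    then have "T \<in> ?F nu" using T nu(4) by simp
    moreover have "nu \<in> P" using nu unfolding P_def by blast
    ultimately show "T \<in> (\<Union>nu\<in>P. ?F nu)" by blast
  qed blast
  moreover have "?F nu \<inter> ?F nu' = {}" if "nu \<in> P" "nu' \<in> P" "nu \<noteq> nu'" for nu nu'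
  proof (rule ccontr)
    assume "?F nu \<inter> ?F nu' \<noteq> {}"
    then obtain T where T: "T \<in> ?F nu" "T \<in> ?F nu'" by blast
    obtain i i' where nu: "nu \<in> shapes d L" "mu \<le> nu" "lam = add_cell d i nu"
      and nu': "nu' \<in> shapes d L" "mu \<le> nu'" "lam = add_cell d i' nu'"
      using \<open>nu \<in> P\<close> \<open>nu' \<in> P\<close> unfolding P_def by blast
    let ?c = "cell d L i (nu i + 1)" and ?c' = "cell d L i' (nu' i' + 1)"
    have c: "diagram d L lam - diagram d L nu = {?c}"
      using skew_diagram_add_cell(3)[OF nu(1) _ nu(2), of i] lam nu(3) by blast
    have c': "diagram d L lam - diagram d L nu' = {?c'}"
      using skew_diagram_add_cell(3)[OF nu'(1) _ nu'(2), of i'] lam nu'(3) by blast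
    have sub: "diagram d L mu \<subseteq> diagram d L nu" "diagram d L mu \<subseteq> diagram d L nu'"
       "diagram d L nu \<subseteq> diagram d L lam" "diagram d L nu' \<subseteq> diagram d L lam"
      using diagram_mono[OF nu(2)] diagram_mono[OF nu'(2)] diagram_mono[OF le_add_cell[of nu d i]]
        diagram_mono[OF le_add_cell[of nu' d i']] nu(3) nu'(3) by simp_all
    have "?c \<in> skew_diagram d L lam mu" "?c' \<in> skew_diagram d L lam mu" "T ?c = T ?c'"
      using c c' sub T unfolding skew_diagram_def by auto
    moreover have "inj_on T (skew_diagram d L lam mu)" using T(1) unfolding SCT_def bij_betw_def by blast
    ultimately have "?c = ?c'" by (meson inj_onD)
    moreover have "diagram d L nu = diagram d L lam - {?c}" using c sub(3) by blast
    moreover have "diagram d L nu' = diagram d L lam - {?c'}" using c' sub(4) by blast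
    ultimately have "diagram d L nu = diagram d L nu'" by simp
    then show False using diagram_inject nu(1) nu'(1) \<open>nu \<noteq> nu'\<close> by blast
  qed
  ultimately have "card (SCT d L lam mu) = (\<Sum>nu\<in>P. card (?F nu))"
    using fin finite_SCT[OF \<open>1 \<le> d\<close> lam mu] card_UN_disjoint[of P ?F] by simp
  then show "card (SCT d L lam mu) = (\<Sum>nu\<in>P. card (SCT d L nu mu))" using fiber by simp
qed

lemma OCT_Nil: "OCT d L [] al be = (if al = be \<and> al \<in> shapes d L then {[al]} else {})"
  by (auto simp: OCT_iff length_Suc_conv)

lemma OCT_one_step:
  "OCT d L [s] al be = (if al \<in> shapes d L \<and> be \<in> shapes d L \<and> sign_step d s al be then {[al, be]} else {})"
proof -
  have "rs \<in> OCT d L [s] al be \<longleftrightarrow> rs = [al, be] \<and> al \<in> shapes d L \<and> be \<in> shapes d L \<and> sign_step d s al be" for rs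
    by (auto simp: OCT_def length_Suc_conv)
  then show ?thesis by auto
qed

lemma OCT_Plus_bounds:
  assumes "1 \<le> d" "OCT d L (replicate N Plus) mu lam \<noteq> {}"
  shows "mu \<le> lam" and "skew_size d lam mu = int N"
proof -
  obtain rs where rs: "rs \<in> OCT d L (replicate N Plus) mu lam" using assms(2) by blast
  have "mu \<le> rs ! k \<and> skew_size d (rs ! k) mu = int k" if "k \<le> N" for k
    using that
  proof (induction k)
    case 0
    then show ?case using rs by (simp add: OCT_iff skew_size_def)
  next
    case (Suc k)
    then have "sign_step d (replicate N Plus ! k) (rs ! k) (rs ! Suc k)" using rs by (simp add: OCT_iff)
    then obtain i where "rs ! Suc k = add_cell d i (rs ! k)" using Suc.prems by auto
    then show ?case
      using Suc le_add_cell[of "rs ! k" d i] skew_size_add_cell[OF \<open>1 \<le> d\<close>, of i "rs ! k" mu]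
      by (auto intro: order_trans)
  qed
  from this[of N] show "mu \<le> lam" "skew_size d lam mu = int N" using rs by (auto simp: OCT_iff)
qed

lemma skew_size_zero:
  assumes "1 \<le> d" "lam \<in> shapes d L" "mu \<in> shapes d L" "mu \<le> lam" "skew_size d lam mu = 0"
  shows "lam = mu"
proof (rule shapes_eqI[OF assms(1-3)])
  fix i assume "i \<in> {1..d}"
  then show "lam i = mu i"
    using skew_size_bound[OF assms(4), of i d] assms(4,5) by (simp add: le_fun_def order_antisym)
qed

text \<open>Splitting off the last step of a walk gives the same recursion as deleting the largest entry of a
  tableau.\<close>

lemma card_SCT_eq_OCT:
  assumes "1 \<le> d" "1 \<le> L" and mu: "mu \<in> shapes d L"
    and "lam \<in> shapes d L" "mu \<le> lam" "skew_size d lam mu = int N"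
  shows "card (SCT d L lam mu) = card (OCT d L (replicate N Plus) mu lam)"
  using assms(4-6)
proof (induction N arbitrary: lam)
  case 0
  then have "lam = mu" using skew_size_zero[OF \<open>1 \<le> d\<close>] mu by simp
  then have "SCT d L lam mu = {\<lambda>_. undefined}"
    using 0 by (auto simp: SCT_def skew_diagram_def bij_betw_def extensional_def)
  then show ?case using \<open>lam = mu\<close> mu by (simp add: OCT_Nil)
next
  case (Suc N)
  let ?P = "{nu \<in> shapes d L. mu \<le> nu \<and> (\<exists>i. lam = add_cell d i nu)}"
  note rec = card_SCT_Suc[OF assms(1,2) mu Suc.prems]
  have "card (OCT d L (replicate N Plus @ [Plus]) mu lam) =
      (\<Sum>nu\<in>?P. card (OCT d L (replicate N Plus) mu nu) * card (OCT d L [Plus] nu lam))"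
  proof (rule card_OCT_append[OF \<open>1 \<le> d\<close> rec(1)])
    fix nu assume a: "OCT d L (replicate N Plus) mu nu \<noteq> {}" "OCT d L [Plus] nu lam \<noteq> {}"
    then show "nu \<in> ?P"
      using OCT_Plus_bounds(1)[OF \<open>1 \<le> d\<close> a(1)] by (auto simp: OCT_one_step split: if_splits)
  qed
  also have "\<dots> = (\<Sum>nu\<in>?P. card (SCT d L nu mu))"
  proof (rule sum.cong[OF refl])
    fix nu assume "nu \<in> ?P"
    then obtain i where nu: "nu \<in> shapes d L" "mu \<le> nu" "lam = add_cell d i nu" by blast
    then have "skew_size d nu mu = int N"
      using Suc.prems(3) skew_size_add_cell[OF \<open>1 \<le> d\<close>, of i nu mu] by simp
    then have "card (SCT d L nu mu) = card (OCT d L (replicate N Plus) mu nu)"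
      using nu Suc.IH by blast
    moreover have "OCT d L [Plus] nu lam = {[nu, lam]}"
      using nu Suc.prems(1) by (auto simp: OCT_one_step)
    ultimately show "card (OCT d L (replicate N Plus) mu nu) * card (OCT d L [Plus] nu lam) = card (SCT d L nu mu)"
      by simp
  qed
  finally show ?case using rec(2) by (simp add: replicate_append_same)
qed

section \<open>The bijection and the two sums\<close>

theorem theorem7p1:
  fixes d L :: int and m n :: nat and al be :: "int \<Rightarrow> int"
  assumes "1 \<le> d" and "1 \<le> L"
    and "al \<in> shapes d L" and "be \<in> shapes d L"
    and "shape_size d al + int m = shape_size d be + int n"
  shows
    "(\<forall>w \<in> sign_words m n. \<exists>f.
        bij_betw f (OCT d L w al be) {G \<in> growth_diagrams d L m n. G (0, n) = al \<and> G (m, 0) = be}) \<and>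
     (\<forall>w \<in> sign_words m n. \<forall>w' \<in> sign_words m n.
        card (OCT d L w al be) = card (OCT d L w' al be)) \<and>
     (\<forall>w \<in> sign_words m n. card (OCT d L w al be) =
        (\<Sum>mu \<in> {mu \<in> shapes d L. mu \<le> al \<and> mu \<le> be \<and>
                   skew_size d al mu = int n \<and> skew_size d be mu = int m}.
           card (SCT d L al mu) * card (SCT d L be mu))) \<and>
     (\<Sum>mu \<in> {mu \<in> shapes d L. mu \<le> al \<and> mu \<le> be \<and>
                skew_size d al mu = int n \<and> skew_size d be mu = int m}.
        card (SCT d L al mu) * card (SCT d L be mu)) =
     (\<Sum>lam \<in> {lam \<in> shapes d L. al \<le> lam \<and> be \<le> lam \<and>
                 skew_size d lam be = int n \<and> skew_size d lam al = int m}.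
        card (SCT d L lam be) * card (SCT d L lam al))"
    (is "?bij \<and> ?indep \<and> ?lower \<and> (\<Sum>mu \<in> ?M. _) = (\<Sum>lam \<in> ?K. _)")
proof -
  let ?MP = "replicate n Minus @ replicate m Plus" and ?PM = "replicate m Plus @ replicate n Minus"
  have sorted: "card (OCT d L w al be) = card (OCT d L ?MP al be)" if "w \<in> sign_words m n" for w
    using equinumerous_words_sort[OF assms(1,2), of w] that
    by (simp add: equinumerous_words_def sign_words_def)
  have PM: "?PM \<in> sign_words m n"
  proof -
    have "count_list (replicate k s) t = (if s = t then k else 0)" for k and s t :: sign
      by (induction k) auto
    then show ?thesis by (simp add: sign_words_def)
  qed
  have lower: "card (OCT d L ?MP al be) = (\<Sum>mu \<in> ?M. card (SCT d L al mu) * card (SCT d L be mu))"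
  proof -
    have "card (OCT d L ?MP al be) =
      (\<Sum>mu\<in>?M. card (OCT d L (replicate n Minus) al mu) * card (OCT d L (replicate m Plus) mu be))"
    proof (rule card_OCT_append[OF assms(1) finite_common_subshapes[OF assms(1)]])
      fix mu assume a: "OCT d L (replicate n Minus) al mu \<noteq> {}" and b: "OCT d L (replicate m Plus) mu be \<noteq> {}"
      have "OCT d L (replicate n Plus) mu al \<noteq> {}"
        using a OCT_rev_Minus[of d L n al mu] finite_OCT[OF assms(1)] by (metis card_0_eq)
      then show "mu \<in> ?M"
        using OCT_Plus_bounds[OF assms(1)] b OCT_endpoints[OF b] by simp
    qed
    also have "\<dots> = (\<Sum>mu \<in> ?M. card (SCT d L al mu) * card (SCT d L be mu))"
      by (intro sum.cong) (simp_all add: OCT_rev_Minus card_SCT_eq_OCT[OF assms(1,2)] assms(3,4))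
    finally show ?thesis .
  qed
  have upper: "card (OCT d L ?PM al be) = (\<Sum>lam \<in> ?K. card (SCT d L lam be) * card (SCT d L lam al))"
  proof -
    have "card (OCT d L ?PM al be) =
      (\<Sum>lam\<in>?K. card (OCT d L (replicate m Plus) al lam) * card (OCT d L (replicate n Minus) lam be))"
    proof (rule card_OCT_append[OF assms(1) finite_common_supershapes[OF assms(1)]])
      fix lam assume a: "OCT d L (replicate m Plus) al lam \<noteq> {}" and b: "OCT d L (replicate n Minus) lam be \<noteq> {}"
      have "OCT d L (replicate n Plus) be lam \<noteq> {}"
        using b OCT_rev_Minus[of d L n lam be] finite_OCT[OF assms(1)] by (metis card_0_eq)
      then show "lam \<in> ?K"
        using OCT_Plus_bounds[OF assms(1)] a OCT_endpoints[OF a] by simp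
    qed
    also have "\<dots> = (\<Sum>lam \<in> ?K. card (SCT d L lam be) * card (SCT d L lam al))"
      by (intro sum.cong) (simp_all add: OCT_rev_Minus card_SCT_eq_OCT[OF assms(1,2)] assms(3,4))
    finally show ?thesis .
  qed
  have corner: "bij_betw (corner_path m n) {G \<in> growth_diagrams d L m n. G (0, n) = al \<and> G (m, 0) = be}
      (OCT d L ?MP al be)"
    by (rule bij_betw_corner_path[OF assms(1,2)])
  have ?bij
  proof
    fix w assume "w \<in> sign_words m n"
    then have "card (OCT d L w al be) = card {G \<in> growth_diagrams d L m n. G (0, n) = al \<and> G (m, 0) = be}"
      using sorted bij_betw_same_card[OF corner] by simp
    moreover have "finite {G \<in> growth_diagrams d L m n. G (0, n) = al \<and> G (m, 0) = be}"
      using bij_betw_finite[OF corner] finite_OCT[OF assms(1)] by blast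
    ultimately show "\<exists>f. bij_betw f (OCT d L w al be) {G \<in> growth_diagrams d L m n. G (0, n) = al \<and> G (m, 0) = be}"
      using finite_same_card_bij[OF finite_OCT[OF assms(1)]] by blast
  qed
  then show ?thesis using sorted lower upper sorted[OF PM] by simp
qed

end
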